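(* Let $G=(V,E,\mathrm{lab})$ be an edge-labeled graph over a set of labels $L$. The algorithms GreedyAnd-$\alpha$ and GreedyOr-$\alpha$ (defined in the context, for a constant $\alpha\in\mathbb{R}$) run in $O(p\log |L|+|V|+|E|)$ time, where $p=|\{(e,k) : e\in E,\ k\in \mathrm{lab}(e)\}|$ is the number of edge-label pairs.
   Context: An edge-labeled graph is a tuple $G=(V,E,\mathrm{lab})$, where $V$ is the set of vertices, $E$ is a set of undirected edges between distinct vertices, and $\mathrm{lab}:E\to 2^L$ maps each edge to its set of labels; $L$ is the set of all possible labels. For a label $\ell$, $E(\ell)$ is the set of edges having label $\ell$ and $V(\ell)$ is the set of vertices adjacent to $E(\ell)$. For $B\subseteq L$, the conjunctive-induced (resp. disjunctive-induced) subgraph consists of the edges $e$ with $B\subseteq \mathrm{lab}(e)$ (resp. $B\cap\mathrm{lab}(e)\neq\emptyset$) and the vertices adjacent to them. The $\alpha$-density of a graph is its number of edges minus $\alpha$ times its number of vertices. Algorithm GreedyAnd-$\alpha$: 1. Set $n_\ell\gets|V(\ell)|$ and $m_\ell\gets|E(\ell)|$ for each label $\ell\in L$, and $r_{v,\ell}\gets|\{e\in E(\ell): e \text{ is adjacent to } v\}|$ for each vertex $v$ and label $\ell$. Let $T$ be the labels sorted by the values $m_\ell-\alpha n_\ell$ (e.g. in a red-black tree). Set $A_0\gets\emptyset$ and $i\gets0$. 2. While there are labels: pick and remove the label $k$ that has the maximum value in $T$; set $A_{i+1}\gets A_i\cup\{k\}$; for each edge $e=(u,v)$ without label $k$: for each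 label $\ell$ of $e$, decrease $m_\ell$, $r_{v,\ell}$ and $r_{u,\ell}$ by one, decrease $n_\ell$ by one if $r_{v,\ell}=0$, and decrease $n_\ell$ by one if $r_{u,\ell}=0$; then remove the edge $e$. After this loop over edges, update $T$ for all labels $\ell$ with changed values of $m_\ell$ or $n_\ell$, and set $i\gets i+1$. 3. Return the set of labels $A_i$ whose conjunctive-induced subgraph has the highest $\alpha$-density. Algorithm GreedyOr-$\alpha$: 1. Set $n\gets0$, $m\gets0$; $n_\ell\gets|V(\ell)|$ and $m_\ell\gets|E(\ell)|$ for each label $\ell\in L$; $S_v\gets\{\ell\in L:$ there is an edge with label $\ell$ adjacent to $v\}$ and $r_v\gets0$ for each vertex $v$. Let $T$ be the labels sorted by the values $m_\ell-\alpha n_\ell$ (e.g. in a red-black tree). Set $A_0\gets\emptyset$ and $i\gets0$. 2. While there are labels: pick and remove the label $k$ that has the maximum value in $T$; set $A_{i+1}\gets A_i\cup\{k\}$; for each edge $e=(u,v)$ with label $k$: decrease $m_\ell$ by one for each label $\ell$ of $e$; set $m\gets m+1$; if $r_v=0$, decrease $n_\ell$ by one for each $\ell\in S_v$ and set $n\gets n+1$; if $r_u=0$, decrease $n_\ell$ by one for each $\ell\in S_u$ and set $n\gets n+1$; set $r_v\gets1$, $r_u\gets1$; remove the edge $e$. After this loop over edges, update $T$ for all labels $\ell$ with changed values of $m_\ell$ or $n_\ell$, and set $i\gets i+1$. 3. Return the set of labels $A_i$ whose disjunctive-induced subgraph has the highest $\alpha$-density.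
   Formalization: It is additionally assumed that every label in L occurs on at least one edge (otherwise the |L| rounds of the loop can exceed the bound, e.g. when E is empty) and that V is nonempty (otherwise the bound is 0). *)

theory Defs
  imports
    Complex_Main
    "HOL-Library.Landau_Symbols"
    "HOL-Library.State_Monad"
    "HOL-Library.While_Combinator"
    "HOL-Library.RBT_Impl"
    "HOL-Library.Product_Lexorder"
begin

section \<open>Edge-labeled undirected graphs\<close>

record ('v, 'l) elgraph =
  verts :: "'v set"
  edges :: "'v set set"
  lab :: "'v set \<Rightarrow> 'l set"
  labels :: "'l set"

definition edge_labeled_graph :: "('v, 'l) elgraph \<Rightarrow> bool" where
  "edge_labeled_graph G \<longleftrightarrow>
     finite (verts G) \<and> finite (labels G) \<and>
     (\<forall>e \<in> edges G. e \<subseteq> verts G \<and> card e = 2) \<and>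
     (\<forall>e \<in> edges G. lab G e \<subseteq> labels G)"

definition edge_label_pairs :: "('v, 'l) elgraph \<Rightarrow> ('v set \<times> 'l) set" where
  "edge_label_pairs G = {(e, k). e \<in> edges G \<and> k \<in> lab G e}"

text \<open>
  The data the algorithms read: lists of the vertices, the labels and the edges, and for each
  edge a list of its labels.  An edge appears with one of its two orientations.
\<close>

record ('v, 'l) input =
  vlist :: "'v list"
  llist :: "'l list"
  elist :: "('v \<times> 'v) list"
  labs :: "'v \<times> 'v \<Rightarrow> 'l list"

definition represents :: "('v, 'l) input \<Rightarrow> ('v, 'l) elgraph \<Rightarrow> bool" where
  "represents I G \<longleftrightarrow>
     distinct (vlist I) \<and> set (vlist I) = verts G \<and>
     distinct (llist I) \<and> set (llist I) = labels G \<and>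
     distinct (map (\<lambda>(u, v). {u, v}) (elist I)) \<and>
     (\<lambda>(u, v). {u, v}) ` set (elist I) = edges G \<and>
     (\<forall>(u, v) \<in> set (elist I).
        distinct (labs I (u, v)) \<and> set (labs I (u, v)) = lab G {u, v})"


section \<open>Step-counting programs\<close>

text \<open>
  Programs live in the library's state monad, over a store that carries a step counter.
  The machine is a random access machine with real arithmetic: reading or writing a variable or
  an array cell, one iteration of a loop (including its final test), and one node visited in a
  search tree take one step each.  Arrays are functions, indexed by vertices, labels, edges or
  vertex-label pairs.  Each piece of straight-line code between two such steps has a fixed number
  of arithmetic operations, comparisons and list constructor or destructor applications, which
  are not counted separately.
\<close>

record clock =
  steps :: nat

type_synonym ('z, 'a) prog = "('z clock_scheme, 'a) state"

definition tick :: "nat \<Rightarrow> ('z, unit) prog" where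
  "tick c = State_Monad.update (\<lambda>s. s\<lparr>steps := steps s + c\<rparr>)"

abbreviation skip :: "('z, unit) prog" where
  "skip \<equiv> State_Monad.return ()"

definition getv :: "('z clock_scheme \<Rightarrow> 'a) \<Rightarrow> ('z, 'a) prog" where
  "getv x = do {tick 1; s \<leftarrow> State_Monad.get; State_Monad.return (x s)}"

definition setv ::
  "(('a \<Rightarrow> 'a) \<Rightarrow> 'z clock_scheme \<Rightarrow> 'z clock_scheme) \<Rightarrow> 'a \<Rightarrow> ('z, unit) prog" where
  "setv x_upd a = do {tick 1; State_Monad.update (x_upd (\<lambda>_. a))}"

definition rd :: "('z clock_scheme \<Rightarrow> 'i \<Rightarrow> 'a) \<Rightarrow> 'i \<Rightarrow> ('z, 'a) prog" where
  "rd x i = do {tick 1; s \<leftarrow> State_Monad.get; State_Monad.return (x s i)}"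

definition wr ::
  "((('i \<Rightarrow> 'a) \<Rightarrow> 'i \<Rightarrow> 'a) \<Rightarrow> 'z clock_scheme \<Rightarrow> 'z clock_scheme) \<Rightarrow> 'i \<Rightarrow> 'a
     \<Rightarrow> ('z, unit) prog" where
  "wr x_upd i a = do {tick 1; State_Monad.update (x_upd (\<lambda>f. f(i := a)))}"

primrec for_each :: "'a list \<Rightarrow> ('a \<Rightarrow> ('z, unit) prog) \<Rightarrow> ('z, unit) prog" where
  "for_each [] body = tick 1"
| "for_each (x # xs) body = do {tick 1; body x; for_each xs body}"

definition while_prog ::
  "('z clock_scheme \<Rightarrow> bool) \<Rightarrow> ('z, unit) prog \<Rightarrow> ('z, unit) prog" where
  "while_prog b body =
     do {State_Monad.update (while b (\<lambda>s. snd (run_state (do {tick 1; body}) s))); tick 1}"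


section \<open>Red-black trees\<close>

text \<open>
  The trees are the library's.  The functions \<open>T_\<dots>\<close> count the recursive calls of the
  corresponding operations; rebalancing at a node (\<open>balance\<close>, \<open>balance_left\<close>, \<open>balance_right\<close>,
  \<open>paint\<close>) is not recursive.
\<close>

fun T_rbt_ins :: "'a::linorder \<Rightarrow> ('a, 'b) rbt \<Rightarrow> nat" where
  "T_rbt_ins k rbt.Empty = 1"
| "T_rbt_ins k (rbt.Branch c l x y r) =
     (if k < x then T_rbt_ins k l else if k > x then T_rbt_ins k r else 0) + 1"

fun T_combine :: "('a, 'b) rbt \<Rightarrow> ('a, 'b) rbt \<Rightarrow> nat" where
  "T_combine rbt.Empty x = 1"
| "T_combine x rbt.Empty = 1"
| "T_combine (rbt.Branch color.R a k x b) (rbt.Branch color.R c s y d) = T_combine b c + 1"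
| "T_combine (rbt.Branch color.B a k x b) (rbt.Branch color.B c s y d) = T_combine b c + 1"
| "T_combine a (rbt.Branch color.R b k x c) = T_combine a b + 1"
| "T_combine (rbt.Branch color.R a k x b) c = T_combine b c + 1"

fun T_rbt_del :: "'a::linorder \<Rightarrow> ('a, 'b) rbt \<Rightarrow> nat" where
  "T_rbt_del x rbt.Empty = 1"
| "T_rbt_del x (rbt.Branch c a y s b) =
     (if x < y then T_rbt_del x a else if x > y then T_rbt_del x b else T_combine a b) + 1"

fun rbt_max :: "('a, 'b) rbt \<Rightarrow> 'a" where
  "rbt_max rbt.Empty = undefined"
| "rbt_max (rbt.Branch c l k x r) = (case r of rbt.Empty \<Rightarrow> k | _ \<Rightarrow> rbt_max r)"

fun T_rbt_max :: "('a, 'b) rbt \<Rightarrow> nat" where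
  "T_rbt_max rbt.Empty = 1"
| "T_rbt_max (rbt.Branch c l k x r) = (case r of rbt.Empty \<Rightarrow> 0 | _ \<Rightarrow> T_rbt_max r) + 1"


section \<open>The part common to both algorithms\<close>

text \<open>
  The tree \<open>queue\<close> is the \<open>T\<close> of the algorithms: its keys are the pairs of the value
  \<open>m\<^sub>\<ell> - \<alpha> n\<^sub>\<ell>\<close> and \<open>\<ell>\<close>, for the labels \<open>\<ell>\<close> not yet picked, so that ties are broken by the order
  on the labels.  The value under which \<open>\<ell>\<close> is filed is kept in \<open>key\<close>.  The list \<open>changed\<close>,
  with characteristic array \<open>is_changed\<close>, collects the labels whose \<open>m\<^sub>\<ell>\<close> or \<open>n\<^sub>\<ell>\<close> has changed.
  The list \<open>incident \<ell>\<close> is \<open>E(\<ell>)\<close> in the input graph, \<open>chosen\<close> is \<open>A\<^sub>i\<close>, and \<open>best\<close> is the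
  best \<open>A\<^sub>j\<close> so far.
\<close>

record ('v, 'l) store = clock +
  m_of :: "'l \<Rightarrow> nat"
  n_of :: "'l \<Rightarrow> nat"
  incident :: "'l \<Rightarrow> ('v \<times> 'v) list"
  queue :: "(real \<times> 'l, unit) rbt"
  queued :: "'l \<Rightarrow> bool"
  key :: "'l \<Rightarrow> real"
  is_changed :: "'l \<Rightarrow> bool"
  changed :: "'l list"
  chosen :: "'l list"
  best :: "'l list"
  best_density :: real

type_synonym ('v, 'l, 'z, 'a) sprog = "(('v, 'l, 'z) store_scheme, 'a) state"

definition queue_insert :: "real \<times> 'l::linorder \<Rightarrow> ('v, 'l, 'z, unit) sprog" where
  "queue_insert x = do {
     t \<leftarrow> getv queue;
     tick (T_rbt_ins x t);
     setv queue_update (rbt_insert x () t)}"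

definition queue_delete :: "real \<times> 'l::linorder \<Rightarrow> ('v, 'l, 'z, unit) sprog" where
  "queue_delete x = do {
     t \<leftarrow> getv queue;
     tick (T_rbt_del x t);
     setv queue_update (rbt_delete x t)}"

definition queue_max :: "('v, 'l::linorder, 'z, real \<times> 'l) sprog" where
  "queue_max = do {
     t \<leftarrow> getv queue;
     tick (T_rbt_max t);
     State_Monad.return (rbt_max t)}"

definition init_label :: "'l \<Rightarrow> ('v, 'l, 'z, unit) sprog" where
  "init_label l = do {
     wr m_of_update l 0;
     wr n_of_update l 0;
     wr incident_update l [];
     wr queued_update l True;
     wr is_changed_update l False}"

definition inc_m :: "'l \<Rightarrow> ('v, 'l, 'z, unit) sprog" where
  "inc_m l = do {x \<leftarrow> rd m_of l; wr m_of_update l (x + 1)}"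

definition inc_n :: "'l \<Rightarrow> ('v, 'l, 'z, unit) sprog" where
  "inc_n l = do {x \<leftarrow> rd n_of l; wr n_of_update l (x + 1)}"

definition add_incident :: "'l \<Rightarrow> 'v \<times> 'v \<Rightarrow> ('v, 'l, 'z, unit) sprog" where
  "add_incident l e = do {es \<leftarrow> rd incident l; wr incident_update l (e # es)}"

definition note_change :: "'l \<Rightarrow> ('v, 'l, 'z, unit) sprog" where
  "note_change l = do {
     c \<leftarrow> rd is_changed l;
     if c then skip
     else do {
       wr is_changed_update l True;
       ls \<leftarrow> getv changed;
       setv changed_update (l # ls)}}"

definition dec_m :: "'l \<Rightarrow> ('v, 'l, 'z, unit) sprog" where
  "dec_m l = do {x \<leftarrow> rd m_of l; wr m_of_update l (x - 1); note_change l}"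

definition dec_n :: "'l \<Rightarrow> ('v, 'l, 'z, unit) sprog" where
  "dec_n l = do {x \<leftarrow> rd n_of l; wr n_of_update l (x - 1); note_change l}"

definition enqueue :: "real \<Rightarrow> 'l::linorder \<Rightarrow> ('v, 'l, 'z, unit) sprog" where
  "enqueue \<alpha> l = do {
     m \<leftarrow> rd m_of l;
     n \<leftarrow> rd n_of l;
     let x = real m - \<alpha> * real n;
     wr key_update l x;
     queue_insert (x, l)}"

definition init_queue ::
  "real \<Rightarrow> ('v, 'l::linorder) input \<Rightarrow> ('v, 'l, 'z, unit) sprog" where
  "init_queue \<alpha> I = do {
     setv queue_update rbt.Empty;
     for_each (llist I) (enqueue \<alpha>);
     setv changed_update [];
     setv chosen_update []}"

definition pick_max :: "('v, 'l::linorder, 'z, real \<times> 'l) sprog" where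
  "pick_max = do {
     (x, k) \<leftarrow> queue_max;
     queue_delete (x, k);
     wr queued_update k False;
     A \<leftarrow> getv chosen;
     setv chosen_update (k # A);
     State_Monad.return (x, k)}"

definition update_queue :: "real \<Rightarrow> ('v, 'l::linorder, 'z, unit) sprog" where
  "update_queue \<alpha> = do {
     ls \<leftarrow> getv changed;
     for_each ls (\<lambda>l. do {
       wr is_changed_update l False;
       q \<leftarrow> rd queued l;
       if q then do {x \<leftarrow> rd key l; queue_delete (x, l); enqueue \<alpha> l} else skip});
     setv changed_update []}"

definition init_best :: "real \<Rightarrow> ('v, 'l, 'z, unit) sprog" where
  "init_best d = do {
     A \<leftarrow> getv chosen;
     setv best_update A;
     setv best_density_update d}"

definition update_best :: "real \<Rightarrow> ('v, 'l, 'z, unit) sprog" where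
  "update_best d = do {
     b \<leftarrow> getv best_density;
     if b < d then init_best d else skip}"


section \<open>GreedyAnd\<close>

text \<open>
  The algorithm has to find the remaining edges without the picked label \<open>k\<close>.  In round \<open>i\<close>, all
  edges in \<open>E(k)\<close> are first stamped with \<open>i\<close>; the scan of the remaining edges then
  looks at the stamps.  The number of edges and of non-isolated vertices is counted in \<open>m_all\<close>
  and \<open>n_all\<close> for the density of the subgraph induced by \<open>A\<^sub>0 = {}\<close>, which has all the edges.
\<close>

record ('v, 'l) and_store = "('v, 'l) store" +
  deg :: "'v \<times> 'l \<Rightarrow> nat"
  remaining :: "('v \<times> 'v) list"
  stamp :: "'v \<times> 'v \<Rightarrow> nat"
  round :: nat
  covered :: "'v \<Rightarrow> bool"
  m_all :: nat
  n_all :: nat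

type_synonym ('v, 'l, 'a) and_prog = "(('v, 'l) and_store, 'a) state"

definition inc_deg :: "'v \<Rightarrow> 'l \<Rightarrow> ('v, 'l, unit) and_prog" where
  "inc_deg v l = do {
     x \<leftarrow> rd deg (v, l);
     wr deg_update (v, l) (x + 1);
     if x = 0 then inc_n l else skip}"

definition dec_deg :: "'v \<Rightarrow> 'l \<Rightarrow> ('v, 'l, unit) and_prog" where
  "dec_deg v l = do {
     x \<leftarrow> rd deg (v, l);
     wr deg_update (v, l) (x - 1);
     if x - 1 = 0 then dec_n l else skip}"

definition cover :: "'v \<Rightarrow> ('v, 'l, unit) and_prog" where
  "cover v = do {
     c \<leftarrow> rd covered v;
     if c then skip
     else do {
       wr covered_update v True;
       n \<leftarrow> getv n_all;
       setv n_all_update (n + 1)}}"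

definition add_remaining :: "'v \<times> 'v \<Rightarrow> ('v, 'l, unit) and_prog" where
  "add_remaining e = do {es \<leftarrow> getv remaining; setv remaining_update (e # es)}"

definition and_init :: "real \<Rightarrow> ('v, 'l::linorder) input \<Rightarrow> ('v, 'l, unit) and_prog" where
  "and_init \<alpha> I = do {
     for_each (vlist I) (\<lambda>v. wr covered_update v False);
     for_each (llist I) init_label;
     for_each (elist I) (\<lambda>(u, v). for_each (labs I (u, v)) (\<lambda>l. do {
       wr deg_update (u, l) 0;
       wr deg_update (v, l) 0}));
     setv remaining_update [];
     setv m_all_update 0;
     setv n_all_update 0;
     for_each (elist I) (\<lambda>(u, v). do {
       wr stamp_update (u, v) 0;
       add_remaining (u, v);
       m \<leftarrow> getv m_all;
       setv m_all_update (m + 1);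
       cover u;
       cover v;
       for_each (labs I (u, v)) (\<lambda>l. do {
         inc_m l;
         add_incident l (u, v);
         inc_deg u l;
         inc_deg v l})});
     init_queue \<alpha> I;
     setv round_update 0;
     m \<leftarrow> getv m_all;
     n \<leftarrow> getv n_all;
     init_best (real m - \<alpha> * real n)}"

definition and_remove_edge :: "('v, 'l) input \<Rightarrow> 'v \<times> 'v \<Rightarrow> ('v, 'l, unit) and_prog" where
  "and_remove_edge I = (\<lambda>(u, v). for_each (labs I (u, v)) (\<lambda>l. do {
     dec_m l;
     dec_deg v l;
     dec_deg u l}))"

text \<open>
  The value \<open>d\<close> under which \<open>k\<close> is filed when it is picked is the density of the subgraph induced by
  \<open>A\<^sub>i \<union> {k}\<close>, since the remaining edges are those with all labels in \<open>A\<^sub>i\<close>.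
\<close>

definition and_round :: "real \<Rightarrow> ('v, 'l::linorder) input \<Rightarrow> ('v, 'l, unit) and_prog" where
  "and_round \<alpha> I = do {
     (d, k) \<leftarrow> pick_max;
     i \<leftarrow> getv round;
     setv round_update (i + 1);
     es \<leftarrow> rd incident k;
     for_each es (\<lambda>e. wr stamp_update e (i + 1));
     es \<leftarrow> getv remaining;
     setv remaining_update [];
     for_each es (\<lambda>e. do {
       j \<leftarrow> rd stamp e;
       if j = i + 1 then add_remaining e else and_remove_edge I e});
     update_queue \<alpha>;
     update_best d}"

definition greedy_and :: "real \<Rightarrow> ('v, 'l::linorder) input \<Rightarrow> ('v, 'l, 'l list) and_prog" where
  "greedy_and \<alpha> I = do {
     and_init \<alpha> I;
     while_prog (\<lambda>s. queue s \<noteq> rbt.Empty) (and_round \<alpha> I);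
     getv best}"


section \<open>GreedyOr\<close>

text \<open>
  The lists \<open>around v\<close> are the sets \<open>S\<^sub>v\<close>; the array \<open>is_around\<close> serves to build them without
  repetitions.  A removed edge stays in the lists \<open>incident\<close> but is skipped.
\<close>

record ('v, 'l) or_store = "('v, 'l) store" +
  around :: "'v \<Rightarrow> 'l list"
  is_around :: "'v \<times> 'l \<Rightarrow> bool"
  reached :: "'v \<Rightarrow> nat"
  removed :: "'v \<times> 'v \<Rightarrow> bool"
  m_cur :: nat
  n_cur :: nat

type_synonym ('v, 'l, 'a) or_prog = "(('v, 'l) or_store, 'a) state"

definition add_around :: "'v \<Rightarrow> 'l \<Rightarrow> ('v, 'l, unit) or_prog" where
  "add_around v l = do {
     a \<leftarrow> rd is_around (v, l);
     if a then skip
     else do {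
       wr is_around_update (v, l) True;
       ls \<leftarrow> rd around v;
       wr around_update v (l # ls);
       inc_n l}}"

definition or_init :: "real \<Rightarrow> ('v, 'l::linorder) input \<Rightarrow> ('v, 'l, unit) or_prog" where
  "or_init \<alpha> I = do {
     setv m_cur_update 0;
     setv n_cur_update 0;
     for_each (vlist I) (\<lambda>v. do {
       wr around_update v [];
       wr reached_update v 0});
     for_each (llist I) init_label;
     for_each (elist I) (\<lambda>(u, v). for_each (labs I (u, v)) (\<lambda>l. do {
       wr is_around_update (u, l) False;
       wr is_around_update (v, l) False}));
     for_each (elist I) (\<lambda>(u, v). do {
       wr removed_update (u, v) False;
       for_each (labs I (u, v)) (\<lambda>l. do {
         inc_m l;
         add_incident l (u, v);
         add_around u l;
         add_around v l})});
     init_queue \<alpha> I;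
     init_best 0}"

definition reach :: "'v \<Rightarrow> ('v, 'l, unit) or_prog" where
  "reach v = do {
     r \<leftarrow> rd reached v;
     if r = 0 then do {
       ls \<leftarrow> rd around v;
       for_each ls dec_n;
       n \<leftarrow> getv n_cur;
       setv n_cur_update (n + 1)}
     else skip}"

definition or_remove_edge :: "('v, 'l) input \<Rightarrow> 'v \<times> 'v \<Rightarrow> ('v, 'l, unit) or_prog" where
  "or_remove_edge I = (\<lambda>(u, v). do {
     for_each (labs I (u, v)) dec_m;
     m \<leftarrow> getv m_cur;
     setv m_cur_update (m + 1);
     reach v;
     reach u;
     wr reached_update v 1;
     wr reached_update u 1;
     wr removed_update (u, v) True})"

definition or_round :: "real \<Rightarrow> ('v, 'l::linorder) input \<Rightarrow> ('v, 'l, unit) or_prog" where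
  "or_round \<alpha> I = do {
     (_, k) \<leftarrow> pick_max;
     es \<leftarrow> rd incident k;
     for_each es (\<lambda>e. do {
       x \<leftarrow> rd removed e;
       if x then skip else or_remove_edge I e});
     update_queue \<alpha>;
     m \<leftarrow> getv m_cur;
     n \<leftarrow> getv n_cur;
     update_best (real m - \<alpha> * real n)}"

definition greedy_or :: "real \<Rightarrow> ('v, 'l::linorder) input \<Rightarrow> ('v, 'l, 'l list) or_prog" where
  "greedy_or \<alpha> I = do {
     or_init \<alpha> I;
     while_prog (\<lambda>s. queue s \<noteq> rbt.Empty) (or_round \<alpha> I);
     getv best}"


section \<open>Running time\<close>

text \<open>The memory is uninitialised at the start.\<close>

definition running_time :: "('z, 'a) prog \<Rightarrow> nat" where
  "running_time P = steps (snd (run_state P (undefined\<lparr>steps := 0\<rparr>)))"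

text \<open>
  A label without edges is picked in some round all the same, so the bound needs every label to
  occur on some edge; otherwise the number of labels would not be bounded by the number of
  edge-label pairs.  The empty graph is left out because the bound is 0 there.

  Landau symbols over the principal filter mean that one constant works for all instances.
\<close>

definition instances :: "(('v, 'l) elgraph \<times> ('v, 'l) input) filter" where
  "instances = principal {(G, I).
     edge_labeled_graph G \<and> verts G \<noteq> {} \<and> labels G = (\<Union>e \<in> edges G. lab G e) \<and>
     represents I G}"

definition time_bound :: "('v, 'l) elgraph \<Rightarrow> real" where
  "time_bound G =
     real (card (edge_label_pairs G)) * log 2 (real (card (labels G)))
     + real (card (verts G)) + real (card (edges G))"

end

theory Submission
  imports Defs
begin

text \<open>
  The proof is an amortised analysis.  A tree operation costs at most \<open>D = O(log |L|)\<close> steps, since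
  the tree never holds more than one entry per label.  Each label is picked once, which pays for a
  constant number of tree operations and for walking along \<open>E(\<ell>)\<close>.  Each edge is removed at most
  once, which pays \<open>O(D)\<close> for each of its labels.  In GreedyAnd a remaining edge survives a scan only
  if it carries the picked label, so it is scanned at most once more than it has labels.  In GreedyOr
  a vertex is reached at most once, which pays \<open>O(D)\<close> for each label around it, and there are at most
  \<open>2p\<close> pairs of a vertex and a label around it.  The total is \<open>O(|V| + |E| + (p + |L|) D)\<close> with
  \<open>|L| \<le> p\<close>.  The values of the counters \<open>m\<^sub>\<ell>\<close> and \<open>n\<^sub>\<ell>\<close> are irrelevant to the running time.
\<close>

section \<open>Search costs in red-black trees\<close>

fun rbt_depth :: "('a, 'b) rbt \<Rightarrow> nat" where
  "rbt_depth rbt.Empty = 0"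
| "rbt_depth (rbt.Branch c l k x r) = max (rbt_depth l) (rbt_depth r) + 1"

lemma T_rbt_ins_le: "T_rbt_ins k t \<le> rbt_depth t + 1"
  by (induction k t rule: T_rbt_ins.induct) auto

lemma T_combine_le: "T_combine a b \<le> rbt_depth a + rbt_depth b + 1"
  by (induction a b rule: T_combine.induct) auto

text \<open>Deletion first descends to the key; then \<open>combine\<close> joins the two subtrees
  of that node and walks down in both of them. This is where the factor 2 comes from.\<close>

lemma T_rbt_del_le: "T_rbt_del x t \<le> 2 * rbt_depth t + 1"
proof (induction x t rule: T_rbt_del.induct)
  case (2 x c a y s b)
  then show ?case
    using T_combine_le[of a b] by auto
qed simp

lemma T_rbt_max_le: "T_rbt_max t \<le> rbt_depth t + 1"
proof (induction t)
  case (Branch c l k x r)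
  then show ?case
    by (cases r) auto
qed simp

lemma rbt_max_in_keys: "t \<noteq> rbt.Empty \<Longrightarrow> rbt_max t \<in> set (RBT_Impl.keys t)"
proof (induction t)
  case (Branch c l k x r)
  then show ?case
    by (cases r) auto
qed simp

text \<open>By \<open>inv1\<close> the children of a red node are black, so each red node on a path,
  except a red root, is preceded by a black one of its own. The summand for a red root carries the
  induction.\<close>

lemma rbt_depth_le_bheight:
  "inv1 t \<Longrightarrow> inv2 t \<Longrightarrow> rbt_depth t \<le> 2 * bheight t + (if color_of t = color.R then 1 else 0)"
proof (induction t)
  case (Branch c l k x r)
  then show ?case
    by (cases c) (auto split: if_splits)
qed simp

lemma two_power_bheight_le: "inv2 t \<Longrightarrow> 2 ^ bheight t \<le> length (RBT_Impl.keys t) + 1"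
proof (induction t)
  case (Branch c l k x r)
  then show ?case
    by (cases c) auto
qed simp

text \<open>The root is black, so the summand for a red root drops out. Only an upper bound
  \<open>n\<close> on the number of keys is fixed, so the number of labels can serve while the tree
  shrinks.\<close>

lemma rbt_depth_le_log:
  fixes t :: "('a::linorder, 'b) rbt"
  assumes "is_rbt t" "card (set (RBT_Impl.keys t)) \<le> n"
  shows "real (rbt_depth t) \<le> 2 * log 2 (real (n + 1))"
proof -
  have "length (RBT_Impl.keys t) \<le> n"
    using assms distinct_card[OF distinct_keys[of t]] by (simp add: is_rbt_def)
  then have "2 ^ bheight t \<le> n + 1"
    using assms two_power_bheight_le[of t] by (simp add: is_rbt_def)
  then have "(2::real) ^ bheight t \<le> real (n + 1)"
    by (metis of_nat_le_iff of_nat_numeral of_nat_power)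
  then have "real (bheight t) \<le> log 2 (real (n + 1))"
    by (simp add: le_log_iff powr_realpow)
  moreover have "rbt_depth t \<le> 2 * bheight t"
    using assms rbt_depth_le_bheight[of t] by (simp add: is_rbt_def)
  ultimately show ?thesis
    by linarith
qed

text \<open>Read off from \<open>rbt_lookup\<close>, whose domain is the set of keys of a sorted
  tree.\<close>

lemma set_keys_rbt_insert:
  fixes t :: "('a::linorder, 'b) rbt"
  assumes "is_rbt t"
  shows "set (RBT_Impl.keys (rbt_insert x y t)) = insert x (set (RBT_Impl.keys t))"
proof -
  have "dom (rbt_lookup (rbt_insert x y t)) = insert x (dom (rbt_lookup t))"
    by (simp add: rbt_lookup_rbt_insert assms)
  then show ?thesis
    using assms by (metis is_rbt_rbt_sorted rbt_insert_is_rbt rbt_lookup_keys)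
qed

lemma set_keys_rbt_delete:
  fixes t :: "('a::linorder, 'b) rbt"
  assumes "is_rbt t"
  shows "set (RBT_Impl.keys (rbt_delete x t)) = set (RBT_Impl.keys t) - {x}"
proof -
  have "dom (rbt_lookup (rbt_delete x t)) = dom (rbt_lookup t) - {x}"
    by (auto simp: rbt_lookup_rbt_delete assms)
  then show ?thesis
    using assms by (metis is_rbt_rbt_sorted rbt_delete_is_rbt rbt_lookup_keys)
qed


section \<open>Weakest preconditions\<close>

text \<open>Programs are functions of the store and the step counter is a field of it, so evaluating
  a postcondition at the final state treats cost and memory together.\<close>

definition wp :: "('s, 'a) state \<Rightarrow> ('a \<Rightarrow> 's \<Rightarrow> bool) \<Rightarrow> 's \<Rightarrow> bool" where
  "wp c Q s \<longleftrightarrow> (case run_state c s of (a, s') \<Rightarrow> Q a s')"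

lemma wp_return: "wp (State_Monad.return a) Q s = Q a s"
  by (simp add: wp_def)

lemma wp_bind: "wp (State_Monad.bind c f) Q s = wp c (\<lambda>a. wp (f a) Q) s"
  by (simp add: wp_def split: prod.split)

lemma wp_update: "wp (State_Monad.update f) Q s = Q () (f s)"
  by (simp add: wp_def State_Monad.update_def)

lemma wp_get: "wp State_Monad.get Q s = Q s s"
  by (simp add: wp_def)

lemma wp_tick: "wp (tick c) Q s = Q () (s\<lparr>steps := steps s + c\<rparr>)"
  by (simp add: tick_def wp_update)

lemma wp_getv: "wp (getv x) Q s = Q (x (s\<lparr>steps := steps s + 1\<rparr>)) (s\<lparr>steps := steps s + 1\<rparr>)"
  by (simp add: getv_def wp_bind wp_tick wp_get wp_return)

lemma wp_setv: "wp (setv x_upd a) Q s = Q () (x_upd (\<lambda>_. a) (s\<lparr>steps := steps s + 1\<rparr>))"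
  by (simp add: setv_def wp_bind wp_tick wp_update)

lemma wp_rd: "wp (rd x i) Q s = Q (x (s\<lparr>steps := steps s + 1\<rparr>) i) (s\<lparr>steps := steps s + 1\<rparr>)"
  by (simp add: rd_def wp_bind wp_tick wp_get wp_return)

lemma wp_wr: "wp (wr x_upd i a) Q s = Q () (x_upd (\<lambda>f. f(i := a)) (s\<lparr>steps := steps s + 1\<rparr>))"
  by (simp add: wr_def wp_bind wp_tick wp_update)

lemma wp_if: "wp (if b then c else d) Q s = (if b then wp c Q s else wp d Q s)"
  by simp

lemmas wp_simps = wp_return wp_bind wp_tick wp_getv wp_setv wp_rd wp_wr wp_if

lemma wp_mono: "wp c Q s \<Longrightarrow> (\<And>a s'. Q a s' \<Longrightarrow> Q' a s') \<Longrightarrow> wp c Q' s"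
  by (auto simp: wp_def)

text \<open>The invariant depends on the prefix already processed, so it can count iterations and
  record which elements were visited.\<close>

lemma wp_for_each:
  assumes "J [] s"
    and step: "\<And>ys x zs s. xs = ys @ x # zs \<Longrightarrow> J ys s
      \<Longrightarrow> wp (body x) (\<lambda>_. J (ys @ [x])) (s\<lparr>steps := steps s + 1\<rparr>)"
    and post: "\<And>s. J xs s \<Longrightarrow> Q () (s\<lparr>steps := steps s + 1\<rparr>)"
  shows "wp (for_each xs body) Q s"
proof -
  have "wp (for_each zs body) Q s" if "J ys s" "xs = ys @ zs" for ys zs s
    using that
  proof (induction zs arbitrary: ys s)
    case Nil
    then show ?case
      using post[of s] by (simp add: wp_simps)
  next
    case (Cons x zs)
    then have "wp (body x) (\<lambda>_. J (ys @ [x])) (s\<lparr>steps := steps s + 1\<rparr>)"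
      by (intro step)
    then have "wp (body x) (\<lambda>_. wp (for_each zs body) Q) (s\<lparr>steps := steps s + 1\<rparr>)"
      using Cons.IH[of "ys @ [x]"] Cons.prems by (elim wp_mono) simp
    then show ?case
      by (simp add: wp_simps)
  qed
  then show ?thesis
    using assms(1) by simp
qed

text \<open>The decreasing measure \<open>\<mu>\<close> makes the loop terminate, so that
  \<open>while_rule2\<close> applies.\<close>

lemma wp_while_prog:
  fixes \<mu> :: "'z clock_scheme \<Rightarrow> nat"
  assumes "J s"
    and step: "\<And>s. J s \<Longrightarrow> b s \<Longrightarrow> wp body (\<lambda>_ s'. J s' \<and> \<mu> s' < \<mu> s) (s\<lparr>steps := steps s + 1\<rparr>)"
    and post: "\<And>s. J s \<Longrightarrow> \<not> b s \<Longrightarrow> Q () (s\<lparr>steps := steps s + 1\<rparr>)"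
  shows "wp (while_prog b body) Q s"
proof -
  let ?c = "\<lambda>s. snd (run_state (do {tick 1; body}) s)"
  have "J (?c s) \<and> \<mu> (?c s) < \<mu> s" if "J s" "b s" for s
    using step[OF that] by (simp add: wp_def tick_def State_Monad.update_def split: prod.splits)
  then have "Q () ((while b ?c s)\<lparr>steps := steps (while b ?c s) + 1\<rparr>)"
    by (intro while_rule2[where P = J and r = "Wellfounded.measure \<mu>" and s = s and b = b and c = ?c
          and Q = "\<lambda>t. Q () (t\<lparr>steps := steps t + 1\<rparr>)"])
      (use \<open>J s\<close> post in \<open>simp_all\<close>)
  then show ?thesis
    unfolding while_prog_def wp_bind wp_update wp_tick .
qed

text \<open>The initial store is \<open>undefined\<close> apart from its counter, so the bound is
  asked for every store whose counter is 0.\<close>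

lemma running_time_le:
  assumes "\<And>s. steps s = 0 \<Longrightarrow> wp P (\<lambda>_ s'. steps s' \<le> n) s"
  shows "running_time P \<le> n"
  using assms[of "undefined\<lparr>steps := 0\<rparr>"] by (simp add: running_time_def wp_def split: prod.splits)


section \<open>The queue of labels\<close>

text \<open>\<open>D\<close> bounds the cost of an operation on a tree with at most one key per label.\<close>

locale greedy_input =
  fixes I :: "('v, 'l::linorder) input" and D :: nat
  assumes distinct_elist: "distinct (elist I)"
    and distinct_llist: "distinct (llist I)"
    and edge_ends: "(u, v) \<in> set (elist I) \<Longrightarrow> u \<noteq> v \<and> u \<in> set (vlist I) \<and> v \<in> set (vlist I)"
    and labs_subset: "e \<in> set (elist I) \<Longrightarrow> set (labs I e) \<subseteq> set (llist I)"
    and distinct_labs: "e \<in> set (elist I) \<Longrightarrow> distinct (labs I e)"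
    and T_queue_le: "is_rbt (t :: (real \<times> 'l, unit) rbt)
      \<Longrightarrow> card (set (RBT_Impl.keys t)) \<le> length (llist I)
      \<Longrightarrow> T_rbt_ins x t \<le> D \<and> T_rbt_del x t \<le> D \<and> T_rbt_max t \<le> D"
begin

abbreviation L :: "'l set" where
  "L \<equiv> set (llist I)"

text \<open>The set \<open>A\<close> is a parameter because the tree is incomplete while it is being
  filled and between the deletion and the reinsertion of a label. Entries use \<open>key\<close>,
  the value at the last filing, from which the current \<open>m_of\<close> and \<open>n_of\<close>
  may have moved away.\<close>

definition filed :: "'l set \<Rightarrow> ('v, 'l, 'z) store_scheme \<Rightarrow> bool" where
  "filed A s \<longleftrightarrow> A \<subseteq> L \<and> is_rbt (queue s)
     \<and> set (RBT_Impl.keys (queue s)) = (\<lambda>l. (key s l, l)) ` A"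

definition queue_ok :: "('v, 'l, 'z) store_scheme \<Rightarrow> bool" where
  "queue_ok s \<longleftrightarrow> filed {l \<in> L. queued s l} s"

lemma filed_update [simp]:
  "filed A (s\<lparr>steps := n\<rparr>) = filed A s"
  "filed A (is_changed_update f s) = filed A s"
  by (simp_all add: filed_def)

lemma queue_ok_update [simp]:
  "queue_ok (s\<lparr>steps := n\<rparr>) = queue_ok s"
  "queue_ok (is_changed_update f s) = queue_ok s"
  "queue_ok (changed_update g s) = queue_ok s"
  "queue_ok (chosen_update g s) = queue_ok s"
  "queue_ok (best_update g s) = queue_ok s"
  "queue_ok (best_density_update h s) = queue_ok s"
  "queue_ok (store.more_update m s) = queue_ok s"
  by (simp_all add: queue_ok_def filed_def)

lemma queue_ok_cong:
  "queue s' = queue s \<Longrightarrow> queued s' = queued s \<Longrightarrow> key s' = key s \<Longrightarrow> queue_ok s' = queue_ok s"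
  by (simp add: queue_ok_def filed_def)

lemma T_filed_le:
  assumes "filed A s"
  shows "T_rbt_ins x (queue s) \<le> D" "T_rbt_del x (queue s) \<le> D" "T_rbt_max (queue s) \<le> D"
proof -
  have "card (set (RBT_Impl.keys (queue s))) \<le> card A"
    using assms finite_subset[of A L] by (simp add: filed_def card_image_le)
  also have "\<dots> \<le> length (llist I)"
    using assms by (metis card_length card_mono filed_def finite_set le_trans)
  finally show "T_rbt_ins x (queue s) \<le> D" "T_rbt_del x (queue s) \<le> D" "T_rbt_max (queue s) \<le> D"
    using assms T_queue_le by (auto simp: filed_def)
qed

lemma wp_enqueue:
  assumes "filed A s" "l \<in> L" "l \<notin> A"
  shows "wp (enqueue \<alpha> l) (\<lambda>_ s'. filed (insert l A) s' \<and> steps s' \<le> steps s + D + 5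
    \<and> queued s' = queued s \<and> changed s' = changed s \<and> incident s' = incident s
    \<and> store.more s' = store.more s) s"
proof -
  \<comment> \<open>Overwriting \<open>key\<close> at \<open>l\<close> leaves the entries of
    \<open>A\<close> intact, since \<open>l\<close> is not in \<open>A\<close>.\<close>
  have "(\<lambda>l'. (if l' = l then x else key s l', l')) ` A = (\<lambda>l'. (key s l', l')) ` A" for x
    using assms by (intro image_cong) auto
  then show ?thesis
    using T_filed_le(1)[OF assms(1)] assms
    by (simp add: enqueue_def queue_insert_def wp_simps Let_def filed_def set_keys_rbt_insert fun_upd_apply)
qed

lemma filed_delete:
  assumes "filed A s" "l \<in> A"
  shows "filed (A - {l}) (s\<lparr>queue := rbt_delete (key s l, l) (queue s)\<rparr>)"
  using assms by (auto simp: filed_def set_keys_rbt_delete)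

lemma wp_queue_delete:
  assumes "filed A s" "l \<in> A" "x = key s l"
  shows "wp (queue_delete (x, l)) (\<lambda>_ s'. filed (A - {l}) s' \<and> steps s' \<le> steps s + D + 2
    \<and> queued s' = queued s \<and> changed s' = changed s \<and> incident s' = incident s
    \<and> store.more s' = store.more s) s"
  using T_filed_le(2)[OF assms(1), of "(key s l, l)"] filed_delete[OF assms(1,2)] assms(3)
  by (auto simp: queue_delete_def wp_simps filed_def)

lemma wp_init_queue:
  assumes "\<And>l. l \<in> L \<Longrightarrow> queued s l"
  shows "wp (init_queue \<alpha> I) (\<lambda>_ s'. queue_ok s'
    \<and> steps s' \<le> steps s + (D + 6) * length (llist I) + 4
    \<and> queued s' = queued s \<and> changed s' = [] \<and> incident s' = incident s
    \<and> store.more s' = store.more s) s"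
  unfolding init_queue_def wp_simps
proof (rule wp_for_each[where J = "\<lambda>ys s'. filed (set ys) s'
    \<and> steps s' \<le> steps s + (D + 6) * length ys + 1
    \<and> queued s' = queued s \<and> incident s' = incident s \<and> store.more s' = store.more s"], goal_cases)
  case 1
  then show ?case
    by (simp add: filed_def)
next
  case (2 ys x zs s')
  have "x \<in> L" "x \<notin> set ys"
    using 2 distinct_llist by auto
  then show ?case
    using 2 by (intro wp_mono[OF wp_enqueue[where A = "set ys"]]) (auto simp: filed_def)
next
  case (3 s')
  have "{l \<in> L. queued s l} = L"
    using assms by auto
  then show ?case
    using 3 by (auto simp: queue_ok_def filed_def)
qed

text \<open>The maximum of a nonempty tree is one of its keys, hence a pair
  \<open>(key s k, k)\<close> with \<open>k\<close> still queued; deleting that pair takes exactly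
  \<open>k\<close> out.\<close>

lemma wp_pick_max:
  assumes "queue_ok s" "queue s \<noteq> rbt.Empty"
  shows "wp pick_max (\<lambda>(x, k) s'. k \<in> L \<and> queued s k \<and> queued s' = (queued s)(k := False)
    \<and> queue_ok s' \<and> steps s' \<le> steps s + 2 * D + 6 \<and> changed s' = changed s
    \<and> incident s' = incident s \<and> store.more s' = store.more s) s"
proof -
  let ?A = "{l \<in> L. queued s l}"
  have filed: "filed ?A s"
    using assms by (simp add: queue_ok_def)
  then obtain k where k: "rbt_max (queue s) = (key s k, k)" "k \<in> ?A"
    using rbt_max_in_keys[OF assms(2)] unfolding filed_def by blast
  have "?A - {k} = {l \<in> L. l \<noteq> k \<and> queued s l}"
    by auto
  then show ?thesis
    using k T_filed_le(2)[OF filed, of "(key s k, k)"] T_filed_le(3)[OF filed] filed_delete[OF filed k(2)]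
    by (auto simp: pick_max_def queue_max_def queue_delete_def wp_simps queue_ok_def filed_def)
qed

text \<open>One entry costs \<open>2 * D + 11\<close>: a loop step, a write, two reads,
  \<open>D + 2\<close> for the deletion and \<open>D + 5\<close> for the new filing. A label already
  picked is merely unmarked.\<close>

lemma wp_update_queue:
  assumes "queue_ok s" "set (changed s) \<subseteq> L"
  shows "wp (update_queue \<alpha>) (\<lambda>_ s'. queue_ok s'
    \<and> steps s' \<le> steps s + (2 * D + 11) * length (changed s) + 4
    \<and> queued s' = queued s \<and> changed s' = [] \<and> incident s' = incident s
    \<and> store.more s' = store.more s) s"
  unfolding update_queue_def wp_simps
proof (rule wp_for_each[where J = "\<lambda>ys s'. queue_ok s'
    \<and> steps s' \<le> steps s + (2 * D + 11) * length ys + 1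
    \<and> queued s' = queued s \<and> incident s' = incident s \<and> store.more s' = store.more s"], goal_cases)
  case 1
  then show ?case
    using assms by (simp add: queue_ok_def filed_def)
next
  case (2 ys x zs s')
  have x: "x \<in> L"
    using 2 assms(2) by auto
  let ?A = "{l \<in> L. queued s l}"
  show ?case
  proof (cases "queued s x")
    case True
    then have A: "x \<in> ?A" "insert x (?A - {x}) = ?A"
      using x by auto
    have "filed ?A s'"
      using 2 by (auto simp add: queue_ok_def)
    then show ?thesis
      using 2 True A x
      by (auto simp: wp_simps queue_ok_def intro!: wp_mono[OF wp_queue_delete[where A = ?A]]
          wp_mono[OF wp_enqueue[where A = "?A - {x}"]])
  next
    case False
    then show ?thesis
      using 2 by (simp add: wp_simps queue_ok_def filed_def)
  qed
next
  case (3 s')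
  then show ?case
    by (simp add: queue_ok_def filed_def)
qed

section \<open>Counting edge-label pairs\<close>

text \<open>The order is reversed because \<open>add_incident\<close> puts each new edge in
  front.\<close>

definition incident_edges :: "'l \<Rightarrow> ('v \<times> 'v) list" where
  "incident_edges l = filter (\<lambda>e. l \<in> set (labs I e)) (rev (elist I))"

definition num_pairs :: nat where
  "num_pairs = (\<Sum>e\<leftarrow>elist I. length (labs I e))"

definition waiting :: "('v, 'l, 'z) store_scheme \<Rightarrow> 'l set" where
  "waiting s = {l \<in> L. queued s l}"

lemma finite_waiting [simp]: "finite (waiting s)"
  by (simp add: waiting_def)

lemma set_incident_edges: "set (incident_edges l) = {e \<in> set (elist I). l \<in> set (labs I e)}"
  by (auto simp: incident_edges_def)

text \<open>Double counting of the pairs of an edge and one of its labels. The induction stays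
  within \<open>elist I\<close>, where label lists are distinct and contained in
  \<open>L\<close>.\<close>

lemma sum_incident_edges: "(\<Sum>l\<in>L. length (incident_edges l)) = num_pairs"
proof -
  have "(\<Sum>l\<in>L. length (filter (\<lambda>e. l \<in> set (labs I e)) es)) = (\<Sum>e\<leftarrow>es. length (labs I e))"
    if "set es \<subseteq> set (elist I)" for es
    using that
  proof (induction es)
    case (Cons e es)
    have "(\<Sum>l\<in>L. length (filter (\<lambda>e. l \<in> set (labs I e)) (e # es)))
        = (\<Sum>l\<in>L. if l \<in> set (labs I e) then 1 else 0) + (\<Sum>l\<in>L. length (filter (\<lambda>e. l \<in> set (labs I e)) es))"
      by (simp add: sum.distrib[symmetric] if_distrib cong: if_cong)
        (intro sum.cong; simp)
    also have "(\<Sum>l\<in>L. if l \<in> set (labs I e) then 1 else 0) = card (L \<inter> set (labs I e))"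
      by (simp add: sum.If_cases Int_def)
    also have "\<dots> = length (labs I e)"
      using Cons.prems labs_subset[of e] distinct_labs[of e] by (simp add: Int_absorb1 distinct_card)
    finally show ?case
      using Cons by simp
  qed simp
  from this[of "elist I"] show ?thesis
    by (simp add: incident_edges_def num_pairs_def rev_filter[symmetric])
qed


section \<open>GreedyAnd\<close>

definition and_same :: "('v, 'l) and_store \<Rightarrow> ('v, 'l) and_store \<Rightarrow> bool" where
  "and_same s s' \<longleftrightarrow> incident s' = incident s \<and> queue s' = queue s \<and> queued s' = queued s
     \<and> key s' = key s \<and> stamp s' = stamp s \<and> round s' = round s \<and> remaining s' = remaining s"

lemma queue_ok_and_update [simp]:
  fixes s :: "('v, 'l) and_store"
  shows "queue_ok (remaining_update f s) = queue_ok s" "queue_ok (round_update g s) = queue_ok s"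
    "queue_ok (stamp_update h s) = queue_ok s"
  by (simp_all add: queue_ok_def filed_def)

text \<open>The queue operations preserve \<open>store.more\<close> as a whole; this turns that into
  equalities of the fields specific to GreedyAnd.\<close>

lemma and_fields:
  fixes s s' :: "('v, 'l) and_store"
  assumes "store.more s' = store.more s"
  shows "stamp s' = stamp s \<and> round s' = round s \<and> remaining s' = remaining s"
  using assms by (cases s; cases s'; simp)

text \<open>Per label: 1 loop step, 6 for \<open>dec_m\<close>, and 8 for each of the two
  \<open>dec_deg\<close> if it calls \<open>dec_n\<close>. Each of the three notes at most one
  change.\<close>

lemma wp_and_remove_edge:
  "wp (and_remove_edge I e) (\<lambda>_ s'. and_same s s'
     \<and> steps s' \<le> steps s + 23 * length (labs I e) + 1
     \<and> length (changed s') \<le> length (changed s) + 3 * length (labs I e)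
     \<and> set (changed s') \<subseteq> set (changed s) \<union> set (labs I e)) s"
proof -
  obtain u v where e: "e = (u, v)"
    by force
  show ?thesis
    unfolding and_remove_edge_def e prod.case
  proof (rule wp_for_each[where J = "\<lambda>ys s'. and_same s s'
     \<and> steps s' \<le> steps s + 23 * length ys
     \<and> length (changed s') \<le> length (changed s) + 3 * length ys
     \<and> set (changed s') \<subseteq> set (changed s) \<union> set ys"], goal_cases)
    case (2 ys l zs t)
    then show ?case
      by (auto simp: dec_m_def dec_deg_def dec_n_def note_change_def wp_simps and_same_def)
  qed (auto simp: and_same_def)
qed

text \<open>
  A scan that keeps an edge takes 4 steps and uses up one of its labels.  A removal takes 23 steps
  per label and notes at most 3 changes, each costing \<open>2 * D + 11\<close> in \<open>update_queue\<close>.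
\<close>

definition edge_pot :: "'l set \<Rightarrow> 'v \<times> 'v \<Rightarrow> nat" where
  "edge_pot Q e = 4 * card (set (labs I e) \<inter> Q) + 9 * (D + 10) * length (labs I e) + 5"

text \<open>Pays for the round that picks \<open>k\<close>: two steps for each edge of
  \<open>E(k)\<close>, spent on stamping in GreedyAnd and on reading \<open>removed\<close> in
  GreedyOr, and a fixed part for the queue and the bookkeeping.\<close>

definition label_pot :: "'l set \<Rightarrow> nat" where
  "label_pot Q = (\<Sum>k\<in>Q. 4 * (D + 10) + 2 * length (incident_edges k))"

lemma label_pot_remove:
  "finite Q \<Longrightarrow> k \<in> Q \<Longrightarrow>
    label_pot Q = label_pot (Q - {k}) + 4 * (D + 10) + 2 * length (incident_edges k)"
  by (simp add: label_pot_def sum.remove)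

lemma edge_pot_remove:
  assumes "k \<in> Q" "k \<in> set (labs I e)"
  shows "edge_pot Q e = edge_pot (Q - {k}) e + 4"
proof -
  have "set (labs I e) \<inter> Q = insert k (set (labs I e) \<inter> (Q - {k}))"
    using assms by auto
  then have "card (set (labs I e) \<inter> Q) = Suc (card (set (labs I e) \<inter> (Q - {k})))"
    by (metis (no_types, lifting) DiffE IntD2 List.finite_set card_insert_disjoint finite_Int insertI1)
  then show ?thesis
    by (simp add: edge_pot_def)
qed

lemma edge_pot_lower: "9 * (D + 10) * length (labs I e) + 5 \<le> edge_pot Q e"
  by (simp add: edge_pot_def)

section \<open>One round of GreedyAnd\<close>

text \<open>Steps taken plus potential stay below a fixed \<open>n\<close>. The bound on
  \<open>stamp\<close> makes the number of the next round a fresh stamp.\<close>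

definition and_inv :: "nat \<Rightarrow> ('v, 'l) and_store \<Rightarrow> bool" where
  "and_inv n s \<longleftrightarrow> queue_ok s \<and> changed s = [] \<and> (\<forall>l\<in>L. incident s l = incident_edges l)
     \<and> set (remaining s) \<subseteq> set (elist I) \<and> (\<forall>e\<in>set (elist I). stamp s e \<le> round s)
     \<and> steps s + label_pot (waiting s) + (\<Sum>e\<leftarrow>remaining s. edge_pot (waiting s) e) \<le> n"

definition and_scan :: "nat \<Rightarrow> 'v \<times> 'v \<Rightarrow> ('v, 'l, unit) and_prog" where
  "and_scan i e = do {
     j \<leftarrow> rd stamp e;
     if j = i + 1 then add_remaining e else and_remove_edge I e}"

text \<open>\<open>Q\<close> stands for the waiting labels before \<open>k\<close> was picked: edges
  enter the scan with the potential for \<open>Q\<close>, survivors leave it with that for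
  \<open>Q - {k}\<close>. Noted changes are already charged at their later cost in
  \<open>update_queue\<close>.\<close>

lemma wp_and_scan:
  fixes s :: "('v, 'l) and_store"
  assumes "set es \<subseteq> set (elist I)" "remaining s = []" "changed s = []" "queue_ok s" "k \<in> Q"
    and stamp: "\<And>e. e \<in> set (elist I) \<Longrightarrow> stamp s e = i + 1 \<longleftrightarrow> k \<in> set (labs I e)"
  shows "wp (for_each es (and_scan i)) (\<lambda>_ t. queue_ok t \<and> incident t = incident s
      \<and> queued t = queued s \<and> stamp t = stamp s \<and> round t = round s
      \<and> set (remaining t) \<subseteq> set (elist I) \<and> set (changed t) \<subseteq> L
      \<and> steps t + (2 * D + 11) * length (changed t) + (\<Sum>e\<leftarrow>remaining t. edge_pot (Q - {k}) e)
        \<le> steps s + (\<Sum>e\<leftarrow>es. edge_pot Q e) + 1) s"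
proof (rule wp_for_each[where J = "\<lambda>ys t. queue_ok t \<and> incident t = incident s
      \<and> queued t = queued s \<and> stamp t = stamp s \<and> round t = round s
      \<and> set (remaining t) \<subseteq> set (elist I) \<and> set (changed t) \<subseteq> L
      \<and> steps t + (2 * D + 11) * length (changed t) + (\<Sum>e\<leftarrow>remaining t. edge_pot (Q - {k}) e)
        \<le> steps s + (\<Sum>e\<leftarrow>ys. edge_pot Q e)"], goal_cases)
  case 1
  then show ?case
    using assms by (simp add: queue_ok_def filed_def)
next
  case (2 ys e zs t)
  then have e: "e \<in> set (elist I)"
    using assms(1) by auto
  show ?case
  proof (cases "k \<in> set (labs I e)")
    case True
    then show ?thesis
      using 2 e stamp[OF e] edge_pot_remove[OF assms(5) True]
      by (simp add: and_scan_def wp_simps add_remaining_def queue_ok_def filed_def)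
  next
    case False
    \<comment> \<open>A removal costs at most \<open>23 + 3 * (2 * D + 11) = 6 * D + 56\<close> per
      label and 3 steps besides, namely the loop step, the reading of \<open>stamp\<close> and the
      final test of the inner loop. The potential exceeds this.\<close>
    have *: "a + (2 * D + 11) * c + r \<le> x + (y + edge_pot Q e)"
      if "a \<le> b + 23 * length (labs I e) + 3" "c \<le> d + 3 * length (labs I e)"
        "b + (2 * D + 11) * d + r \<le> x + y" for a b c d r x y
    proof -
      have "(2 * D + 11) * c \<le> (2 * D + 11) * (d + 3 * length (labs I e))"
        using that(2) by (rule mult_le_mono2)
      then show ?thesis
        using that(1,3) edge_pot_lower[of e Q] by (simp add: algebra_simps)
    qed
    show ?thesis
      using False 2 e stamp[OF e] labs_subset[OF e]
      by (auto simp: and_scan_def wp_simps and_same_def queue_ok_def filed_def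
          intro!: wp_mono[OF wp_and_remove_edge] *) blast
  qed
next
  case (3 t)
  then show ?case
    by (simp add: queue_ok_def filed_def)
qed


lemma wp_and_round:
  assumes "and_inv n s" "queue s \<noteq> rbt.Empty"
  shows "wp (and_round \<alpha> I) (\<lambda>_ s'. and_inv n s' \<and> card (waiting s') < card (waiting s))
    (s\<lparr>steps := steps s + 1\<rparr>)"
proof -
  have inv: "queue_ok s" "changed s = []" "\<And>l. l \<in> L \<Longrightarrow> incident s l = incident_edges l"
      "set (remaining s) \<subseteq> set (elist I)" "\<And>e. e \<in> set (elist I) \<Longrightarrow> stamp s e \<le> round s"
      "steps s + label_pot (waiting s) + (\<Sum>e\<leftarrow>remaining s. edge_pot (waiting s) e) \<le> n"
    using assms(1) by (auto simp: and_inv_def)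
  let ?i = "round s"
  \<comment> \<open>So far the round has taken 1 loop step, \<open>2 * D + 6\<close> steps in
    \<open>pick_max\<close>, and 3 steps for \<open>round\<close> and
    \<open>incident k\<close>.\<close>
  have body: "wp (for_each (incident_edges k) (\<lambda>e. wr stamp_update e (Suc ?i))) (\<lambda>_.
      wp (do {
        es \<leftarrow> getv remaining;
        setv remaining_update [];
        for_each es (and_scan ?i);
        update_queue \<alpha>;
        update_best d}) (\<lambda>_ s'. and_inv n s' \<and> card (waiting s') < card (waiting s))) t"
    if k: "k \<in> L" "queued s k" and t: "queued t = (queued s)(k := False)" "queue_ok t"
      "steps t \<le> steps s + 2 * D + 10" "changed t = []" "incident t = incident s"
      "remaining t = remaining s" "stamp t = stamp s" "round t = ?i + 1"
    for k d t
  proof (rule wp_for_each[where J = "\<lambda>ys t'. queued t' = queued t \<and> queue_ok t'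
      \<and> steps t' \<le> steps t + 2 * length ys \<and> changed t' = [] \<and> incident t' = incident t
      \<and> remaining t' = remaining t \<and> round t' = round t
      \<and> stamp t' = (\<lambda>e. if e \<in> set ys then ?i + 1 else stamp s e)"], goal_cases)
    case 1
    then show ?case
      using t by simp
  next
    case (2 ys e zs t')
    then show ?case
      by (auto simp: wp_simps queue_ok_def filed_def)
  next
    case (3 t')
    have k': "k \<in> waiting s"
      using k by (simp add: waiting_def)
    have waiting: "waiting u = waiting s - {k}" if "queued u = (queued s)(k := False)" for u :: "('v, 'l) and_store"
      using that by (auto simp: waiting_def)
    \<comment> \<open>Stamps of earlier rounds are at most \<open>?i\<close>, so exactly the edges
      just visited carry \<open>?i + 1\<close>.\<close>
    have stamp: "stamp t' e = ?i + 1 \<longleftrightarrow> k \<in> set (labs I e)" if "e \<in> set (elist I)" for e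
      using 3 that inv(5)[OF that] by (auto simp: set_incident_edges)
    \<comment> \<open>The 12 consists of 4 steps around the stamping and scanning loops, 4 in
      \<open>update_queue\<close> and 4 in \<open>update_best\<close>.\<close>
    have final: "and_inv n u' \<and> card (waiting u') < card (waiting s)"
      if "queue_ok u'" "incident u' = incident t" "queued u' = queued t" "changed u' = []"
        "stamp u' = stamp t'" "round u' = round t" "set (remaining u') \<subseteq> set (elist I)"
        "steps u' + (\<Sum>e\<leftarrow>remaining u'. edge_pot (waiting s - {k}) e)
          \<le> steps t' + (\<Sum>e\<leftarrow>remaining s. edge_pot (waiting s) e) + 12" for u'
    proof -
      have "card (waiting s - {k}) < card (waiting s)"
        using k' by (intro psubset_card_mono) auto
      moreover have "stamp u' e \<le> round u'" if "e \<in> set (elist I)" for e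
        using that \<open>stamp u' = stamp t'\<close> \<open>round u' = round t\<close> 3 t(8) inv(5)[OF that] by simp
      moreover have "steps u' + label_pot (waiting s - {k}) + (\<Sum>e\<leftarrow>remaining u'. edge_pot (waiting s - {k}) e) \<le> n"
        using that(8) inv(6) label_pot_remove[OF finite_waiting k'] 3 t(3) by simp
      ultimately show ?thesis
        using that t inv(3) waiting[of u'] by (auto simp: and_inv_def)
    qed
    have upd: "wp (update_queue \<alpha>) (\<lambda>_. wp (update_best d)
        (\<lambda>_ s'. and_inv n s' \<and> card (waiting s') < card (waiting s))) u"
      if "queue_ok u" "incident u = incident t" "queued u = queued t"
        "stamp u = stamp t'" "round u = round t" "set (remaining u) \<subseteq> set (elist I)" "set (changed u) \<subseteq> L"
        "steps u + (2 * D + 11) * length (changed u) + (\<Sum>e\<leftarrow>remaining u. edge_pot (waiting s - {k}) e)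
          \<le> steps t' + (\<Sum>e\<leftarrow>remaining s. edge_pot (waiting s) e) + 4" for u
      using that
      by (auto simp: update_best_def init_best_def wp_simps dest!: and_fields
          intro!: wp_mono[OF wp_update_queue] final[THEN conjunct1] final[THEN conjunct2] del: subsetI)
    show ?case
      using 3 t inv(4) k' stamp
      by (auto simp: wp_simps intro!: wp_mono[OF wp_and_scan[where Q = "waiting s" and k = k]] upd)
  qed
  have "wp pick_max (\<lambda>(d, k). wp (do {
      i \<leftarrow> getv round;
      setv round_update (i + 1);
      es \<leftarrow> rd incident k;
      for_each es (\<lambda>e. wr stamp_update e (i + 1));
      es \<leftarrow> getv remaining;
      setv remaining_update [];
      for_each es (and_scan i);
      update_queue \<alpha>;
      update_best d}) (\<lambda>_ s'. and_inv n s' \<and> card (waiting s') < card (waiting s)))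
    (s\<lparr>steps := steps s + 1\<rparr>)"
    apply (rule wp_mono, rule wp_pick_max)
    subgoal using inv(1) by (simp add: queue_ok_def filed_def)
    subgoal using assms(2) by simp
    using inv by (auto simp: wp_simps dest!: and_fields intro!: body)
  then show ?thesis
    unfolding and_round_def and_scan_def by (simp add: case_prod_unfold wp_simps)
qed


section \<open>Initialisation and total cost of GreedyAnd\<close>

lemma wp_init_labels:
  "wp (for_each (llist I) init_label) (\<lambda>_ s'. steps s' \<le> steps s + 6 * length (llist I) + 1
    \<and> (\<forall>l\<in>L. incident s' l = [] \<and> queued s' l) \<and> store.more s' = store.more s) s"
  by (rule wp_for_each[where J = "\<lambda>ys s'. steps s' \<le> steps s + 6 * length ys
      \<and> (\<forall>l\<in>set ys. incident s' l = [] \<and> queued s' l) \<and> store.more s' = store.more s"])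
    (auto simp: init_label_def wp_simps)

text \<open>Only cells for an end of an edge and a label of that edge are reset, which avoids a cost
  of the order of vertices times labels.\<close>

lemma wp_and_clear_deg:
  fixes s :: "('v, 'l) and_store"
  shows "wp (for_each (elist I) (\<lambda>(u, v). for_each (labs I (u, v)) (\<lambda>l. do {
       wr deg_update (u, l) 0;
       wr deg_update (v, l) 0})))
     (\<lambda>_ s'. steps s' \<le> steps s + 2 * length (elist I) + 3 * num_pairs + 1
       \<and> incident s' = incident s \<and> queued s' = queued s) s"
  unfolding num_pairs_def
proof (rule wp_for_each[where J = "\<lambda>ys s'. steps s' \<le> steps s + 2 * length ys
      + 3 * (\<Sum>e\<leftarrow>ys. length (labs I e))
      \<and> incident s' = incident s \<and> queued s' = queued s"], goal_cases)
  case (2 ys e zs t)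
  obtain u v where e: "e = (u, v)"
    by force
  show ?case
    unfolding e prod.case
    by (rule wp_for_each[where J = "\<lambda>ls t'. steps t' \<le> steps t + 3 * length ls + 1
          \<and> incident t' = incident s \<and> queued t' = queued s"])
      (use 2 e in \<open>auto simp: wp_simps\<close>)
qed auto

definition and_load :: "'v \<times> 'v \<Rightarrow> ('v, 'l, unit) and_prog" where
  "and_load = (\<lambda>(u, v). do {
     wr stamp_update (u, v) 0;
     add_remaining (u, v);
     m \<leftarrow> getv m_all;
     setv m_all_update (m + 1);
     cover u;
     cover v;
     for_each (labs I (u, v)) (\<lambda>l. do {
       inc_m l;
       add_incident l (u, v);
       inc_deg u l;
       inc_deg v l})})"

text \<open>Distinctness makes \<open>e\<close> enter each list \<open>incident l\<close> at most
  once. The 13 steps per label are 1 for the loop, 2 each for \<open>inc_m\<close> and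
  \<open>add_incident\<close>, and 4 for each \<open>inc_deg\<close>.\<close>

lemma wp_and_load_labels:
  fixes s :: "('v, 'l) and_store"
  assumes "distinct (labs I e)"
  shows "wp (for_each (labs I e) (\<lambda>l. do {
       inc_m l;
       add_incident l e;
       inc_deg u l;
       inc_deg v l}))
     (\<lambda>_ s'. steps s' \<le> steps s + 13 * length (labs I e) + 1 \<and> queued s' = queued s
       \<and> incident s' = (\<lambda>l. if l \<in> set (labs I e) then e # incident s l else incident s l)
       \<and> stamp s' = stamp s \<and> remaining s' = remaining s) s"
proof (rule wp_for_each[where J = "\<lambda>ls s'. steps s' \<le> steps s + 13 * length ls \<and> queued s' = queued s
       \<and> incident s' = (\<lambda>l. if l \<in> set ls then e # incident s l else incident s l)
       \<and> stamp s' = stamp s \<and> remaining s' = remaining s"], goal_cases)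
  case (2 ys l zs t)
  then have "l \<notin> set ys"
    using assms by auto
  then show ?case
    using 2 by (auto simp: wp_simps inc_m_def add_incident_def inc_deg_def inc_n_def)
qed auto

lemma wp_and_load:
  fixes s :: "('v, 'l) and_store"
  assumes "distinct (labs I e)"
  shows "wp (and_load e)
     (\<lambda>_ s'. steps s' \<le> steps s + 13 * length (labs I e) + 14 \<and> queued s' = queued s
       \<and> incident s' = (\<lambda>l. if l \<in> set (labs I e) then e # incident s l else incident s l)
       \<and> stamp s' = (stamp s)(e := 0) \<and> remaining s' = e # remaining s) s"
proof -
  obtain u v where e: "e = (u, v)"
    by force
  show ?thesis
    using assms
    by (auto simp: e and_load_def wp_simps add_remaining_def cover_def intro!: wp_mono[OF wp_and_load_labels])
qed

lemma wp_and_load_all: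
  fixes s :: "('v, 'l) and_store"
  assumes "\<And>l. l \<in> L \<Longrightarrow> incident s l = []" "remaining s = []"
  shows "wp (for_each (elist I) and_load) 
     (\<lambda>_ s'. steps s' \<le> steps s + 13 * num_pairs + 15 * length (elist I) + 1 \<and> queued s' = queued s
       \<and> (\<forall>l\<in>L. incident s' l = incident_edges l)
       \<and> (\<forall>e\<in>set (elist I). stamp s' e = 0) \<and> remaining s' = rev (elist I)) s"
  unfolding num_pairs_def incident_edges_def
proof (rule wp_for_each[where J = "\<lambda>ys s'. steps s' \<le> steps s + 13 * (\<Sum>e\<leftarrow>ys. length (labs I e)) + 15 * length ys
       \<and> queued s' = queued s
       \<and> (\<forall>l\<in>L. incident s' l = filter (\<lambda>e. l \<in> set (labs I e)) (rev ys))
       \<and> (\<forall>e\<in>set ys. stamp s' e = 0) \<and> remaining s' = rev ys"], goal_cases)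
  case (2 ys e zs t)
  then show ?case
    using distinct_labs[of e] by (auto intro!: wp_mono[OF wp_and_load])
qed (use assms in auto)

text \<open>Dominates initialisation plus initial potential for both algorithms. The coefficients
  \<open>9 * D\<close> and 22 are dictated by GreedyAnd, the 3 per vertex by GreedyOr.\<close>

definition budget :: nat where
  "budget = 3 * length (vlist I) + 22 * length (elist I) + (5 * D + 60) * length (llist I)
     + (9 * D + 120) * num_pairs + 30"

text \<open>At the start all labels are waiting, so each label of an edge contributes 4 on top of
  \<open>9 * (D + 10)\<close>.\<close>

lemma sum_edge_pot: "(\<Sum>e\<leftarrow>rev (elist I). edge_pot L e) = (9 * D + 94) * num_pairs + 5 * length (elist I)"
proof -
  have "(\<Sum>e\<leftarrow>es. edge_pot L e) = (9 * D + 94) * (\<Sum>e\<leftarrow>es. length (labs I e)) + 5 * length es"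
    if "set es \<subseteq> set (elist I)" for es
    using that
  proof (induction es)
    case (Cons e es)
    then have "card (set (labs I e) \<inter> L) = length (labs I e)"
      using labs_subset[of e] distinct_labs[of e] by (simp add: Int_absorb2 distinct_card)
    then show ?case
      using Cons by (simp add: edge_pot_def algebra_simps)
  qed simp
  from this[of "elist I"] show ?thesis
    by (simp add: rev_map[symmetric] num_pairs_def)
qed

lemma label_pot_L: "label_pot L = 4 * (D + 10) * length (llist I) + 2 * num_pairs"
  using distinct_llist
  by (simp add: label_pot_def sum.distrib sum_distrib_left[symmetric] sum_incident_edges distinct_card)

lemma wp_and_init:
  assumes "steps s = 0"
  shows "wp (and_init \<alpha> I) (\<lambda>_. and_inv budget) s"
proof -
  \<comment> \<open>What follows the loading loop is settled first. The 17 per edge and 16 per pair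
    are the sums of clearing (2 and 3) and loading (15 and 13).\<close>
  have init_queue: "wp (init_queue \<alpha> I) (\<lambda>_. wp (do {
     setv round_update 0;
     m \<leftarrow> getv m_all;
     n \<leftarrow> getv n_all;
     init_best (real m - \<alpha> * real n)}) (\<lambda>_. and_inv budget)) t"
    if t: "steps t \<le> 2 * length (vlist I) + 6 * length (llist I) + 17 * length (elist I) + 16 * num_pairs + 7"
      "\<forall>l\<in>L. queued t l" "\<forall>l\<in>L. incident t l = incident_edges l"
      "\<forall>e\<in>set (elist I). stamp t e = 0" "remaining t = rev (elist I)" for t
  proof (rule wp_mono, rule wp_init_queue)
    show "queued t l" if "l \<in> L" for l
      using t that by simp
  next
    fix a u
    assume u: "queue_ok u \<and> steps u \<le> steps t + (D + 6) * length (llist I) + 4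
        \<and> queued u = queued t \<and> changed u = [] \<and> incident u = incident t \<and> store.more u = store.more t"
    have waiting: "waiting u' = L" if "queued u' = queued t" for u' :: "('v, 'l) and_store"
      using t(2) that by (auto simp: waiting_def)
    have init: "and_inv budget u'"
      if "steps u' \<le> steps u + 6" "queue_ok u'" "changed u' = []" "incident u' = incident t" "queued u' = queued t"
        "stamp u' = stamp t" "remaining u' = rev (elist I)" for u'
      using t u that sum_edge_pot label_pot_L waiting[of u']
      by (simp add: and_inv_def budget_def algebra_simps)
    show "wp (do {
     setv round_update 0;
     m \<leftarrow> getv m_all;
     n \<leftarrow> getv n_all;
     init_best (real m - \<alpha> * real n)}) (\<lambda>_. and_inv budget) u"
      using u t by (auto simp: wp_simps init_best_def dest!: and_fields intro!: init)
  qed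
  show ?thesis
    unfolding and_init_def and_load_def[symmetric] wp_simps
    apply (rule wp_for_each[where J = "\<lambda>ys t. steps t \<le> 2 * length ys"])
    subgoal using assms by simp
    subgoal by (simp add: wp_simps)
    apply (rule wp_mono, rule wp_init_labels)
    apply (rule wp_mono, rule wp_and_clear_deg)
    apply (rule wp_mono, rule wp_and_load_all)
    subgoal by simp
    subgoal by simp
    apply (rule init_queue[unfolded wp_simps])
    apply auto
    done
qed

text \<open>Potentials are natural numbers, so the invariant bounds the steps themselves. The 2
  further steps are the last loop test and the reading of \<open>best\<close>.\<close>

lemma running_time_greedy_and: "running_time (greedy_and \<alpha> I) \<le> budget + 2"
proof (rule running_time_le)
  fix s :: "('v, 'l) and_store"
  assume "steps s = 0"
  then show "wp (greedy_and \<alpha> I) (\<lambda>_ s'. steps s' \<le> budget + 2) s"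
    unfolding greedy_and_def wp_simps
    apply (intro wp_mono[OF wp_and_init])
    apply assumption
    apply (rule wp_while_prog[where J = "and_inv budget" and \<mu> = "\<lambda>s. card (waiting s)"])
    apply assumption
    apply (rule wp_and_round; assumption)
    apply (simp add: and_inv_def)
    done
qed

section \<open>GreedyOr\<close>

lemma queue_ok_or_update [simp]:
  fixes s :: "('v, 'l) or_store"
  shows "queue_ok (around_update f s) = queue_ok s" "queue_ok (is_around_update g s) = queue_ok s"
    "queue_ok (reached_update h s) = queue_ok s" "queue_ok (removed_update i s) = queue_ok s"
    "queue_ok (m_cur_update j s) = queue_ok s" "queue_ok (n_cur_update j s) = queue_ok s"
  by (simp_all add: queue_ok_def filed_def)

lemma or_fields:
  fixes s s' :: "('v, 'l) or_store"
  assumes "store.more s' = store.more s"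
  shows "around s' = around s \<and> reached s' = reached s \<and> removed s' = removed s"
  using assms by (cases s; cases s'; simp)

text \<open>Covers both kinds of loop in a removal: \<open>dec_m\<close> over the labels of the edge
  and \<open>dec_n\<close> over the labels around an end.\<close>

lemma wp_for_each_dec:
  assumes "d = dec_m \<or> d = dec_n"
  shows "wp (for_each ls d) (\<lambda>_ s'. steps s' \<le> steps s + 7 * length ls + 1
      \<and> length (changed s') \<le> length (changed s) + length ls
      \<and> set (changed s') \<subseteq> set (changed s) \<union> set ls
      \<and> queue s' = queue s \<and> queued s' = queued s \<and> key s' = key s \<and> incident s' = incident s
      \<and> store.more s' = store.more s) s"
  by (rule wp_for_each[where J = "\<lambda>ys s'. steps s' \<le> steps s + 7 * length ys
      \<and> length (changed s') \<le> length (changed s) + length ys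
      \<and> set (changed s') \<subseteq> set (changed s) \<union> set ys
      \<and> queue s' = queue s \<and> queued s' = queued s \<and> key s' = key s \<and> incident s' = incident s
      \<and> store.more s' = store.more s"])
    (use assms in \<open>auto simp: dec_m_def dec_n_def note_change_def wp_simps\<close>)

text \<open>
  Each decrement takes 7 steps and notes at most one change, which costs \<open>2 * D + 11\<close> in
  \<open>update_queue\<close>.  The latter is already charged to \<open>spent\<close> below when the change is noted.
\<close>

definition vertex_cost :: "('v, 'l) or_store \<Rightarrow> 'v \<Rightarrow> nat" where
  "vertex_cost s v = (if reached s v = 0 then (2 * D + 18) * length (around s v) else 0)"

text \<open>The 16 is the part of a removal independent of labels: 3 for the end of the label loop
  and the update of \<open>m_cur\<close>, 5 for each \<open>reach\<close>, and 3 final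
  writes.\<close>

definition or_edge_cost :: "('v, 'l) or_store \<Rightarrow> 'v \<times> 'v \<Rightarrow> nat" where
  "or_edge_cost s e = (if removed s e then 0 else (2 * D + 18) * length (labs I e) + 16)"

definition or_pot :: "('v, 'l) or_store \<Rightarrow> nat" where
  "or_pot s = (\<Sum>e\<in>set (elist I). or_edge_cost s e) + (\<Sum>v\<in>set (vlist I). vertex_cost s v)"

lemma or_pot_cong:
  "removed t = removed s \<Longrightarrow> around t = around s \<Longrightarrow> reached t = reached s \<Longrightarrow> or_pot t = or_pot s"
  by (simp add: or_pot_def or_edge_cost_def vertex_cost_def cong: if_cong)

lemma or_pot_steps [simp]: "or_pot (s\<lparr>steps := n\<rparr>) = or_pot s"
  by (rule or_pot_cong) simp_all

definition spent :: "('v, 'l, 'z) store_scheme \<Rightarrow> nat" where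
  "spent s = steps s + (2 * D + 11) * length (changed s)"

lemma spent_steps [simp]:
  "spent (s\<lparr>steps := Suc n\<rparr>) = Suc (spent (s\<lparr>steps := n\<rparr>))"
  "spent (s\<lparr>steps := steps s\<rparr>) = spent s"
  by (simp_all add: spent_def)

lemma spent_or_update [simp]:
  fixes s :: "('v, 'l) or_store"
  shows "spent (reached_update h s) = spent s" "spent (removed_update i s) = spent s"
    "spent (m_cur_update j s) = spent s" "spent (n_cur_update j s) = spent s"
  by (simp_all add: spent_def)

lemma spent_le:
  assumes "steps t \<le> steps s + 7 * n + m" "length (changed t) \<le> length (changed s) + n"
  shows "spent t \<le> spent s + (2 * D + 18) * n + m"
proof -
  have "(2 * D + 11) * length (changed t) \<le> (2 * D + 11) * (length (changed s) + n)"
    using assms(2) by (rule mult_le_mono2)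
  then show ?thesis
    using assms(1) by (simp add: spent_def algebra_simps)
qed

section \<open>Removing an edge in GreedyOr\<close>

text \<open>The program leaves \<open>reached\<close> as it is, so the vertex cost is released only
  later, when \<open>or_remove_edge\<close> sets the marks.\<close>

lemma wp_reach:
  fixes s :: "('v, 'l) or_store"
  shows "wp (reach v) (\<lambda>_ s'. spent s' \<le> spent s + vertex_cost s v + 5
      \<and> set (changed s') \<subseteq> set (changed s) \<union> set (around s v)
      \<and> queue s' = queue s \<and> queued s' = queued s \<and> key s' = key s \<and> incident s' = incident s
      \<and> around s' = around s \<and> reached s' = reached s \<and> removed s' = removed s) s"
proof (cases "reached s v = 0")
  case True
  have *: "spent t \<le> 3 + (spent s + vertex_cost s v)"
    if "steps t \<le> steps s + 7 * length (around s v) + 3" "length (changed t) \<le> length (changed s) + length (around s v)"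
    for t :: "('v, 'l) or_store"
    using spent_le[of t s "length (around s v)" 3] that True by (simp add: vertex_cost_def)
  show ?thesis
    using True by (auto simp: reach_def wp_simps dest!: or_fields intro!: wp_mono[OF wp_for_each_dec] *)
next
  case False
  then show ?thesis
    by (auto simp: reach_def wp_simps spent_def)
qed

text \<open>Three summands vanish: that of the edge and those of its ends, which are different
  vertices. An end reached earlier has cost 0 already.\<close>

lemma or_pot_remove:
  assumes "(u, v) \<in> set (elist I)" "\<not> removed s (u, v)" "around t = around s"
    "removed t = (removed s)((u, v) := True)" "reached t = (reached s)(v := 1, u := 1)"
  shows "or_pot s = or_pot t + (2 * D + 18) * length (labs I (u, v)) + 16 + vertex_cost s u + vertex_cost s v"
proof -
  let ?E = "set (elist I)" and ?V = "set (vlist I)"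
  have "(\<Sum>e\<in>?E - {(u, v)}. or_edge_cost t e) = (\<Sum>e\<in>?E - {(u, v)}. or_edge_cost s e)"
    using assms by (intro sum.cong) (auto simp: or_edge_cost_def)
  then have E: "(\<Sum>e\<in>?E. or_edge_cost s e) = (\<Sum>e\<in>?E. or_edge_cost t e) + (2 * D + 18) * length (labs I (u, v)) + 16"
    using assms by (simp add: sum.remove[of ?E "(u, v)"]) (simp add: or_edge_cost_def)
  have uv: "u \<noteq> v" "u \<in> ?V" "v \<in> ?V"
    using edge_ends[OF assms(1)] by auto
  have "(\<Sum>x\<in>?V - {u} - {v}. vertex_cost t x) = (\<Sum>x\<in>?V - {u} - {v}. vertex_cost s x)"
    using assms by (intro sum.cong) (auto simp: vertex_cost_def)
  moreover have "(\<Sum>x\<in>?V. vertex_cost r x)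
      = vertex_cost r u + (vertex_cost r v + (\<Sum>x\<in>?V - {u} - {v}. vertex_cost r x))" for r
    using uv by (simp add: sum.remove[of ?V u] sum.remove[of "?V - {u}" v])
  moreover have "vertex_cost t u = 0" "vertex_cost t v = 0"
    using assms(5) by (auto simp: vertex_cost_def)
  ultimately show ?thesis
    using E by (simp add: or_pot_def)
qed

text \<open>The potential released pays for the removal and for the queue updates it causes, so its
  amortised cost is at most 0.\<close>

lemma wp_or_remove_edge:
  fixes s :: "('v, 'l) or_store"
  assumes e: "e \<in> set (elist I)" "\<not> removed s e" and "queue_ok s" "set (changed s) \<subseteq> L"
    and around: "\<And>v. v \<in> set (vlist I) \<Longrightarrow> set (around s v) \<subseteq> L"
  shows "wp (or_remove_edge I e) (\<lambda>_ s'. spent s' + or_pot s' \<le> spent s + or_pot s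
      \<and> set (changed s') \<subseteq> L \<and> queue_ok s' \<and> queued s' = queued s \<and> incident s' = incident s
      \<and> around s' = around s) s"
proof -
  obtain u v where uv: "e = (u, v)"
    by force
  let ?n = "length (labs I e)"
  \<comment> \<open>The three \<open>Suc\<close> are the final writes; the 13 is 3 up to the first
    \<open>reach\<close> and 5 for each of the two.\<close>
  have final: "Suc (Suc (Suc (x + or_pot t))) \<le> spent s + or_pot s"
    if "x \<le> spent s + (2 * D + 18) * ?n + 13 + vertex_cost s u + vertex_cost s v"
      "around t = around s" "removed t = (removed s)((u, v) := True)" "reached t = (reached s)(v := 1, u := 1)"
    for x t
    using or_pot_remove[of u v s t] that e uv by simp
  have ends: "set (around s u) \<subseteq> L" "set (around s v) \<subseteq> L" "set (labs I e) \<subseteq> L"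
    using around edge_ends e labs_subset unfolding uv by blast+
  \<comment> \<open>Allows both calls of \<open>reach\<close> to be charged at the costs in
    \<open>s\<close>, as neither changes \<open>reached\<close> or \<open>around\<close>.\<close>
  have cost: "vertex_cost t x = vertex_cost s x" if "reached t = reached s" "around t = around s" for t x
    using that by (simp add: vertex_cost_def)
  have reach2: "wp (reach v) (\<lambda>_. wp (do {
       reach u;
       wr reached_update v (Suc 0);
       wr reached_update u (Suc 0);
       wr removed_update (u, v) True}) (\<lambda>_ s'. spent s' + or_pot s' \<le> spent s + or_pot s
      \<and> set (changed s') \<subseteq> L \<and> queue_ok s' \<and> queued s' = queued s \<and> incident s' = incident s
      \<and> around s' = around s)) t"
    if "spent t \<le> spent s + (2 * D + 18) * ?n + 3" "set (changed t) \<subseteq> L" "queue_ok t" "queued t = queued s"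
      "incident t = incident s" "around t = around s" "removed t = removed s" "reached t = reached s" for t
  proof (rule wp_mono, rule wp_reach)
    fix a :: unit and t1 :: "('v, 'l) or_store"
    assume t1: "spent t1 \<le> spent t + vertex_cost t v + 5
      \<and> set (changed t1) \<subseteq> set (changed t) \<union> set (around t v)
      \<and> queue t1 = queue t \<and> queued t1 = queued t \<and> key t1 = key t \<and> incident t1 = incident t
      \<and> around t1 = around t \<and> reached t1 = reached t \<and> removed t1 = removed t"
    have t1': "set (changed t1) \<subseteq> L"
      using t1 ends that(2,6) by auto
    show "wp (do {
       reach u;
       wr reached_update v (Suc 0);
       wr reached_update u (Suc 0);
       wr removed_update (u, v) True}) (\<lambda>_ s'. spent s' + or_pot s' \<le> spent s + or_pot s
      \<and> set (changed s') \<subseteq> L \<and> queue_ok s' \<and> queued s' = queued s \<and> incident s' = incident s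
      \<and> around s' = around s) t1"
      unfolding wp_bind[where c = "reach u"]
    proof (rule wp_mono, rule wp_reach)
      fix a :: unit and t2 :: "('v, 'l) or_store"
      assume t2: "spent t2 \<le> spent t1 + vertex_cost t1 u + 5
        \<and> set (changed t2) \<subseteq> set (changed t1) \<union> set (around t1 u)
        \<and> queue t2 = queue t1 \<and> queued t2 = queued t1 \<and> key t2 = key t1 \<and> incident t2 = incident t1
        \<and> around t2 = around t1 \<and> reached t2 = reached t1 \<and> removed t2 = removed t1"
      have "set (changed t2) \<subseteq> L"
        using t2 t1 t1' ends(1) that(6) by auto
      moreover have "queue_ok t2"
        using t1 t2 that(3) queue_ok_cong[of t2 t] by simp
      moreover have "spent t2 \<le> spent s + (2 * D + 18) * ?n + 13 + vertex_cost s u + vertex_cost s v"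
        using t1 t2 that cost[of t v] cost[of t1 u] by simp
      ultimately show "wp (do {
         wr reached_update v (Suc 0);
         wr reached_update u (Suc 0);
         wr removed_update (u, v) True}) (\<lambda>_ s'. spent s' + or_pot s' \<le> spent s + or_pot s
        \<and> set (changed s') \<subseteq> L \<and> queue_ok s' \<and> queued s' = queued s \<and> incident s' = incident s
        \<and> around s' = around s) t2"
        using t1 t2 that by (auto simp: wp_simps intro!: final del: subsetI)
    qed
  qed
  have *: "spent t \<le> Suc (spent s + (2 * D + 18) * length (labs I (u, v)))"
    if "steps t \<le> Suc (steps s + 7 * length (labs I (u, v)))"
      "length (changed t) \<le> length (changed s) + length (labs I (u, v))" for t :: "('v, 'l) or_store"
    using spent_le[of t s "length (labs I (u, v))" 1] that by simp
  have qcong: "queue_ok t" if "queue t = queue s" "queued t = queued s" "key t = key s" for t :: "('v, 'l) or_store"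
    using that assms(3) queue_ok_cong[of t s] by simp
  have sub: "A \<subseteq> L" if "A \<subseteq> set (changed s) \<union> set (labs I (u, v))" for A
    using that ends(3) assms(4) uv by auto
  show ?thesis
    using uv by (auto simp: or_remove_edge_def wp_simps dest!: or_fields del: subsetI
        intro!: wp_mono[OF wp_for_each_dec] reach2 * qcong sub)
qed

section \<open>One round of GreedyOr\<close>

definition or_inv :: "nat \<Rightarrow> ('v, 'l) or_store \<Rightarrow> bool" where
  "or_inv n s \<longleftrightarrow> queue_ok s \<and> changed s = [] \<and> (\<forall>l\<in>L. incident s l = incident_edges l)
     \<and> (\<forall>v\<in>set (vlist I). set (around s v) \<subseteq> L) \<and> steps s + label_pot (waiting s) + or_pot s \<le> n"

text \<open>Each listed edge leaves only the loop step and the reading of \<open>removed\<close> to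
  be paid from outside; removals are financed by the decrease of \<open>or_pot\<close>.\<close>

lemma wp_or_scan:
  fixes s :: "('v, 'l) or_store"
  assumes "set es \<subseteq> set (elist I)" "changed s = []" "queue_ok s"
    and around: "\<And>v. v \<in> set (vlist I) \<Longrightarrow> set (around s v) \<subseteq> L"
  shows "wp (for_each es (\<lambda>e. do {
       x \<leftarrow> rd removed e;
       if x then skip else or_remove_edge I e})) (\<lambda>_ t. queue_ok t \<and> incident t = incident s
      \<and> queued t = queued s \<and> set (changed t) \<subseteq> L \<and> around t = around s
      \<and> spent t + or_pot t \<le> steps s + or_pot s + 2 * length es + 1) s"
proof (rule wp_for_each[where J = "\<lambda>ys t. queue_ok t \<and> incident t = incident s
      \<and> queued t = queued s \<and> set (changed t) \<subseteq> L \<and> around t = around s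
      \<and> spent t + or_pot t \<le> steps s + or_pot s + 2 * length ys"], goal_cases)
  case 1
  then show ?case
    using assms by (simp add: spent_def)
next
  case (2 ys e zs t)
  then have e: "e \<in> set (elist I)"
    using assms(1) by auto
  show ?case
    using 2 e around by (auto simp: wp_simps del: subsetI intro!: wp_mono[OF wp_or_remove_edge])
next
  case (3 t)
  then show ?case
    by simp
qed


lemma wp_or_round:
  assumes "or_inv n s" "queue s \<noteq> rbt.Empty"
  shows "wp (or_round \<alpha> I) (\<lambda>_ s'. or_inv n s' \<and> card (waiting s') < card (waiting s))
    (s\<lparr>steps := steps s + 1\<rparr>)"
proof -
  have inv: "queue_ok s" "changed s = []" "\<And>l. l \<in> L \<Longrightarrow> incident s l = incident_edges l"
      "\<And>v. v \<in> set (vlist I) \<Longrightarrow> set (around s v) \<subseteq> L"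
      "steps s + label_pot (waiting s) + or_pot s \<le> n"
    using assms(1) by (auto simp: or_inv_def)
  have body: "wp (for_each (incident_edges k) (\<lambda>e. do {
       x \<leftarrow> rd removed e;
       if x then skip else or_remove_edge I e})) (\<lambda>_. wp (do {
         update_queue \<alpha>;
         m \<leftarrow> getv m_cur;
         n \<leftarrow> getv n_cur;
         update_best (real m - \<alpha> * real n)}) (\<lambda>_ s'. or_inv n s' \<and> card (waiting s') < card (waiting s))) t"
    if k: "k \<in> L" "queued s k" and t: "queued t = (queued s)(k := False)" "queue_ok t"
      "steps t \<le> steps s + 2 * D + 8" "changed t = []" "incident t = incident s"
      "around t = around s" "removed t = removed s" "reached t = reached s"
    for k t
  proof (rule wp_mono, rule wp_or_scan)
    show "set (incident_edges k) \<subseteq> set (elist I)"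
      by (auto simp: set_incident_edges)
    show "changed t = []" "queue_ok t"
      using t by auto
    show "set (around t v) \<subseteq> L" if "v \<in> set (vlist I)" for v
      using t inv(4)[OF that] by simp
  next
    fix a :: unit and u :: "('v, 'l) or_store"
    assume u: "queue_ok u \<and> incident u = incident t \<and> queued u = queued t \<and> set (changed u) \<subseteq> L
      \<and> around u = around t \<and> spent u + or_pot u \<le> steps t + or_pot t + 2 * length (incident_edges k) + 1"
    have k': "k \<in> waiting s"
      using k by (simp add: waiting_def)
    \<comment> \<open>The 10 is 4 in \<open>update_queue\<close>, 2 for reading the counters and 4
      in \<open>update_best\<close>.\<close>
    have final: "or_inv n u' \<and> card (waiting u') < card (waiting s)"
      if "queue_ok u'" "incident u' = incident t" "queued u' = (queued s)(k := False)" "changed u' = []" "around u' = around u"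
        "reached u' = reached u" "removed u' = removed u"
        "steps u' \<le> steps u + (2 * D + 11) * length (changed u) + 10" for u' :: "('v, 'l) or_store"
    proof -
      have "card (waiting s - {k}) < card (waiting s)"
        using k' by (intro psubset_card_mono) auto
      moreover have "waiting u' = waiting s - {k}"
        using that(3) by (auto simp: waiting_def)
      moreover have "steps u' + label_pot (waiting s - {k}) + or_pot u' \<le> n"
        using that(8) inv(5) label_pot_remove[OF finite_waiting k'] t(3) u or_pot_cong[of u' u]
          or_pot_cong[of t s] that(5-7) t(6-8) by (simp add: spent_def)
      ultimately show ?thesis
        using that u t inv(3,4) by (auto simp: or_inv_def)
    qed
    show "wp (do {
         update_queue \<alpha>;
         m \<leftarrow> getv m_cur;
         n \<leftarrow> getv n_cur;
         update_best (real m - \<alpha> * real n)}) (\<lambda>_ s'. or_inv n s' \<and> card (waiting s') < card (waiting s)) u"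
      using u t by (auto simp: update_best_def init_best_def wp_simps dest!: or_fields
          intro!: wp_mono[OF wp_update_queue] final[THEN conjunct1] final[THEN conjunct2] del: subsetI)
  qed
  have "wp pick_max (\<lambda>(d, k). wp (do {
      es \<leftarrow> rd incident k;
      for_each es (\<lambda>e. do {
        x \<leftarrow> rd removed e;
        if x then skip else or_remove_edge I e});
      update_queue \<alpha>;
      m \<leftarrow> getv m_cur;
      n \<leftarrow> getv n_cur;
      update_best (real m - \<alpha> * real n)}) (\<lambda>_ s'. or_inv n s' \<and> card (waiting s') < card (waiting s)))
    (s\<lparr>steps := steps s + 1\<rparr>)"
    apply (rule wp_mono, rule wp_pick_max)
    subgoal using inv(1) by simp
    subgoal using assms(2) by simp
    using inv by (auto simp: wp_simps dest!: or_fields intro!: body)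
  then show ?thesis
    unfolding or_round_def by (simp add: case_prod_unfold wp_simps)
qed

section \<open>Initialisation and total cost of GreedyOr\<close>

lemma wp_or_clear_around:
  fixes s :: "('v, 'l) or_store"
  shows "wp (for_each (elist I) (\<lambda>(u, v). for_each (labs I (u, v)) (\<lambda>l. do {
       wr is_around_update (u, l) False;
       wr is_around_update (v, l) False})))
     (\<lambda>_ s'. steps s' \<le> steps s + 2 * length (elist I) + 3 * num_pairs + 1
       \<and> incident s' = incident s \<and> queued s' = queued s \<and> around s' = around s \<and> reached s' = reached s) s"
  unfolding num_pairs_def
proof (rule wp_for_each[where J = "\<lambda>ys s'. steps s' \<le> steps s + 2 * length ys
      + 3 * (\<Sum>e\<leftarrow>ys. length (labs I e))
      \<and> incident s' = incident s \<and> queued s' = queued s \<and> around s' = around s \<and> reached s' = reached s"], goal_cases)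
  case (2 ys e zs t)
  obtain u v where e: "e = (u, v)"
    by force
  show ?case
    unfolding e prod.case
    by (rule wp_for_each[where J = "\<lambda>ls t'. steps t' \<le> steps t + 3 * length ls + 1
          \<and> incident t' = incident s \<and> queued t' = queued s \<and> around t' = around s \<and> reached t' = reached s"])
      (use 2 e in \<open>auto simp: wp_simps\<close>)
qed auto

text \<open>Measures the total work of \<open>reach\<close>. During loading each edge-label pair
  adds at most one at either end, which leads to the bound \<open>2 * num_pairs\<close>.\<close>

definition num_around :: "('v, 'l) or_store \<Rightarrow> nat" where
  "num_around s = (\<Sum>v\<in>set (vlist I). length (around s v))"

lemma num_around_cong [simp]:
  "num_around (s\<lparr>steps := n\<rparr>) = num_around s"
  "num_around (m_of_update f s) = num_around s"
  "num_around (n_of_update f s) = num_around s"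
  "num_around (incident_update g s) = num_around s"
  "num_around (is_around_update h s) = num_around s"
  "num_around (removed_update i s) = num_around s"
  by (simp_all add: num_around_def)

lemma num_around_Cons:
  "num_around (s\<lparr>around := (around s)(v := l # around s v)\<rparr>) \<le> Suc (num_around s)"
proof -
  have "num_around (s\<lparr>around := (around s)(v := l # around s v)\<rparr>)
      \<le> (\<Sum>x\<in>set (vlist I). length (around s x) + (if v = x then 1 else 0))"
    unfolding num_around_def by (intro sum_mono) auto
  also have "\<dots> \<le> Suc (num_around s)"
    by (simp add: sum.distrib num_around_def)
  finally show ?thesis .
qed

lemma wp_add_around:
  fixes s :: "('v, 'l) or_store"
  shows "wp (add_around v l) (\<lambda>_ s'. steps s' \<le> steps s + 6 \<and> num_around s' \<le> Suc (num_around s)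
      \<and> (\<forall>x. set (around s' x) \<subseteq> insert l (set (around s x)))
      \<and> incident s' = incident s \<and> queued s' = queued s \<and> reached s' = reached s \<and> removed s' = removed s) s"
  using num_around_Cons[of s v l] by (auto simp: add_around_def inc_n_def wp_simps num_around_def)

definition or_load :: "'v \<times> 'v \<Rightarrow> ('v, 'l, unit) or_prog" where
  "or_load = (\<lambda>(u, v). do {
       wr removed_update (u, v) False;
       for_each (labs I (u, v)) (\<lambda>l. do {
         inc_m l;
         add_incident l (u, v);
         add_around u l;
         add_around v l})})"

lemma wp_or_load_labels:
  fixes s :: "('v, 'l) or_store"
  assumes "distinct (labs I e)"
  shows "wp (for_each (labs I e) (\<lambda>l. do {
         inc_m l;
         add_incident l e;
         add_around u l;
         add_around v l}))
     (\<lambda>_ s'. steps s' \<le> steps s + 17 * length (labs I e) + 1 \<and> queued s' = queued s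
       \<and> incident s' = (\<lambda>l. if l \<in> set (labs I e) then e # incident s l else incident s l)
       \<and> num_around s' \<le> num_around s + 2 * length (labs I e)
       \<and> (\<forall>x. set (around s' x) \<subseteq> set (labs I e) \<union> set (around s x))
       \<and> removed s' = removed s \<and> reached s' = reached s) s"
proof (rule wp_for_each[where J = "\<lambda>ls s'. steps s' \<le> steps s + 17 * length ls \<and> queued s' = queued s
       \<and> incident s' = (\<lambda>l. if l \<in> set ls then e # incident s l else incident s l)
       \<and> num_around s' \<le> num_around s + 2 * length ls
       \<and> (\<forall>x. set (around s' x) \<subseteq> set ls \<union> set (around s x))
       \<and> removed s' = removed s \<and> reached s' = reached s"], goal_cases)
  case (2 ys l zs t)
  then have "l \<notin> set ys"
    using assms by auto
  then show ?case
    using 2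
    by (auto simp: wp_simps inc_m_def add_incident_def fun_eq_iff intro!: wp_mono[OF wp_add_around]) blast
qed auto

lemma wp_or_load:
  fixes s :: "('v, 'l) or_store"
  assumes "distinct (labs I e)"
  shows "wp (or_load e)
     (\<lambda>_ s'. steps s' \<le> steps s + 17 * length (labs I e) + 2 \<and> queued s' = queued s
       \<and> incident s' = (\<lambda>l. if l \<in> set (labs I e) then e # incident s l else incident s l)
       \<and> num_around s' \<le> num_around s + 2 * length (labs I e)
       \<and> (\<forall>x. set (around s' x) \<subseteq> set (labs I e) \<union> set (around s x))
       \<and> removed s' = (removed s)(e := False) \<and> reached s' = reached s) s"
proof -
  obtain u v where e: "e = (u, v)"
    by force
  show ?thesis
    using assms by (auto simp: e or_load_def wp_simps intro!: wp_mono[OF wp_or_load_labels]) blast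
qed

lemma wp_or_load_all:
  fixes s :: "('v, 'l) or_store"
  assumes "\<And>l. l \<in> L \<Longrightarrow> incident s l = []" "\<And>v. v \<in> set (vlist I) \<Longrightarrow> around s v = []"
  shows "wp (for_each (elist I) or_load)
     (\<lambda>_ s'. steps s' \<le> steps s + 17 * num_pairs + 3 * length (elist I) + 1 \<and> queued s' = queued s
       \<and> (\<forall>l\<in>L. incident s' l = incident_edges l)
       \<and> num_around s' \<le> 2 * num_pairs \<and> (\<forall>x\<in>set (vlist I). set (around s' x) \<subseteq> L)
       \<and> (\<forall>e\<in>set (elist I). \<not> removed s' e) \<and> reached s' = reached s) s"
  unfolding num_pairs_def incident_edges_def
proof (rule wp_for_each[where J = "\<lambda>ys s'. steps s' \<le> steps s + 17 * (\<Sum>e\<leftarrow>ys. length (labs I e)) + 3 * length ys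
       \<and> queued s' = queued s
       \<and> (\<forall>l\<in>L. incident s' l = filter (\<lambda>e. l \<in> set (labs I e)) (rev ys))
       \<and> num_around s' \<le> 2 * (\<Sum>e\<leftarrow>ys. length (labs I e)) \<and> (\<forall>x\<in>set (vlist I). set (around s' x) \<subseteq> L)
       \<and> (\<forall>e\<in>set ys. \<not> removed s' e) \<and> reached s' = reached s"], goal_cases)
  case 1
  then show ?case
    using assms by (simp add: num_around_def)
next
  case (2 ys e zs t)
  then have "distinct (labs I e)" "set (labs I e) \<subseteq> L"
    using distinct_labs[of e] labs_subset[of e] by auto
  then show ?case
    using 2 by (auto intro!: wp_mono[OF wp_or_load] split: if_splits) blast+
next
  case (3 t)
  then show ?case
    by simp
qed


lemma sum_or_edge_cost:
  assumes "\<And>e. e \<in> set (elist I) \<Longrightarrow> \<not> removed s e"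
  shows "(\<Sum>e\<in>set (elist I). or_edge_cost s e) = (2 * D + 18) * num_pairs + 16 * length (elist I)"
proof -
  have "(\<Sum>e\<in>set (elist I). or_edge_cost s e) = (\<Sum>e\<leftarrow>elist I. (2 * D + 18) * length (labs I e) + 16)"
    using assms distinct_elist by (simp add: sum_list_distinct_conv_sum_set or_edge_cost_def)
  then show ?thesis
    by (simp add: num_pairs_def sum_list_addf sum_list_const_mult sum_list_triv)
qed

lemma wp_or_init:
  assumes "steps s = 0"
  shows "wp (or_init \<alpha> I) (\<lambda>_. or_inv budget) s"
proof -
  have init_queue: "wp (init_queue \<alpha> I) (\<lambda>_. wp (init_best 0) (\<lambda>_. or_inv budget)) t"
    if t: "steps t \<le> 3 * length (vlist I) + 6 * length (llist I) + 5 * length (elist I) + 20 * num_pairs + 6"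
      "\<forall>l\<in>L. queued t l" "\<forall>l\<in>L. incident t l = incident_edges l"
      "\<forall>e\<in>set (elist I). \<not> removed t e" "num_around t \<le> 2 * num_pairs"
      "\<forall>v\<in>set (vlist I). set (around t v) \<subseteq> L" "\<forall>v\<in>set (vlist I). reached t v = 0" for t
  proof (rule wp_mono, rule wp_init_queue)
    show "queued t l" if "l \<in> L" for l
      using t that by simp
  next
    fix a :: unit and u :: "('v, 'l) or_store"
    assume u: "queue_ok u \<and> steps u \<le> steps t + (D + 6) * length (llist I) + 4
        \<and> queued u = queued t \<and> changed u = [] \<and> incident u = incident t \<and> store.more u = store.more t"
    have init: "or_inv budget u'"
      if u': "steps u' \<le> steps u + 3" "queue_ok u'" "changed u' = []" "incident u' = incident t" "queued u' = queued t"
        "removed u' = removed t" "around u' = around t" "reached u' = reached t" for u'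
    proof -
      \<comment> \<open>No vertex is reached yet, so all carry their full cost. With the
        \<open>(2 * D + 18) * num_pairs\<close> of the edges this makes three times that amount at
        most, hence \<open>6 * D + 54\<close>.\<close>
      have "(\<Sum>v\<in>set (vlist I). vertex_cost u' v) = (2 * D + 18) * num_around t"
        using u' t(7) by (simp add: vertex_cost_def num_around_def sum_distrib_left)
      also have "\<dots> \<le> (2 * D + 18) * (2 * num_pairs)"
        using t(5) by (rule mult_le_mono2)
      finally have "or_pot u' \<le> (6 * D + 54) * num_pairs + 16 * length (elist I)"
        using sum_or_edge_cost[of u'] u' t(4) by (simp add: or_pot_def algebra_simps)
      moreover have "waiting u' = L"
        using u' t(2) by (auto simp: waiting_def)
      ultimately show ?thesis
        using t(1,3,6) u u' label_pot_L by (simp add: or_inv_def budget_def algebra_simps)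
    qed
    show "wp (init_best 0) (\<lambda>_. or_inv budget) u"
      using u t by (auto simp: wp_simps init_best_def dest!: or_fields intro!: init)
  qed
  show ?thesis
    unfolding or_init_def or_load_def[symmetric] wp_simps
    apply (rule wp_for_each[where J = "\<lambda>ys t. steps t \<le> 3 * length ys + 2
        \<and> (\<forall>v\<in>set ys. around t v = [] \<and> reached t v = 0)"])
    subgoal using assms by simp
    subgoal by (simp add: wp_simps)
    apply (rule wp_mono, rule wp_init_labels)
    apply (rule wp_mono, rule wp_or_clear_around)
    apply (rule wp_mono, rule wp_or_load_all)
    subgoal by simp
    subgoal by (auto dest!: or_fields)
    apply (rule init_queue)
    apply (auto dest!: or_fields)
    done
qed

lemma running_time_greedy_or: "running_time (greedy_or \<alpha> I) \<le> budget + 2"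
proof (rule running_time_le)
  fix s :: "('v, 'l) or_store"
  assume "steps s = 0"
  then show "wp (greedy_or \<alpha> I) (\<lambda>_ s'. steps s' \<le> budget + 2) s"
    unfolding greedy_or_def wp_simps
    apply (intro wp_mono[OF wp_or_init])
    apply assumption
    apply (rule wp_while_prog[where J = "or_inv budget" and \<mu> = "\<lambda>s. card (waiting s)"])
    apply assumption
    apply (rule wp_or_round; assumption)
    apply (simp add: or_inv_def)
    done
qed

end


section \<open>The running time in terms of the graph\<close>

locale graph_input =
  fixes G :: "('v, 'l::linorder) elgraph" and I :: "('v, 'l) input"
  assumes graph: "edge_labeled_graph G" and verts: "verts G \<noteq> {}"
    and labels: "labels G = (\<Union>e \<in> edges G. lab G e)" and represents: "represents I G"
begin

lemma labs_edge:
  assumes "(u, v) \<in> set (elist I)"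
  shows "distinct (labs I (u, v)) \<and> set (labs I (u, v)) = lab G {u, v}"
proof -
  have "\<forall>(u, v) \<in> set (elist I). distinct (labs I (u, v)) \<and> set (labs I (u, v)) = lab G {u, v}"
    using represents by (simp add: represents_def)
  from bspec[OF this assms] show ?thesis
    by simp
qed

lemma edges_eq: "edges G = (\<lambda>(u, v). {u, v}) ` set (elist I)"
  using represents by (simp add: represents_def)

lemma edge_in_edges: "(u, v) \<in> set (elist I) \<Longrightarrow> {u, v} \<in> edges G"
  unfolding edges_eq by (rule image_eqI[where x = "(u, v)"]) simp_all

text \<open>Each operation takes at most \<open>2 * rbt_depth t + 1\<close> steps and the depth is
  at most twice the logarithm. Rounding down is safe because \<open>2 * rbt_depth t\<close> is an
  integer.\<close>

definition D :: nat where
  "D = nat \<lfloor>4 * log 2 (real (length (llist I) + 1))\<rfloor> + 1"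

sublocale greedy_input I D
proof
  show "distinct (elist I)" "distinct (llist I)"
    using represents by (auto simp: represents_def distinct_map)
next
  fix u v
  assume "(u, v) \<in> set (elist I)"
  then have "{u, v} \<in> edges G"
    by (rule edge_in_edges)
  then have "{u, v} \<subseteq> verts G" "card {u, v} = 2"
    using graph by (auto simp: edge_labeled_graph_def)
  then show "u \<noteq> v \<and> u \<in> set (vlist I) \<and> v \<in> set (vlist I)"
    using represents by (auto simp: represents_def)
next
  fix e
  assume e: "e \<in> set (elist I)"
  obtain u v where uv: "e = (u, v)"
    by force
  have "{u, v} \<in> edges G"
    using e uv edge_in_edges by simp
  then have "lab G {u, v} \<subseteq> set (llist I)"
    using graph represents by (auto simp: edge_labeled_graph_def represents_def)
  then show "set (labs I e) \<subseteq> set (llist I)" "distinct (labs I e)"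
    using labs_edge[of u v] e uv by auto
next
  fix t :: "(real \<times> 'l, unit) rbt" and x
  assume "is_rbt t" "card (set (RBT_Impl.keys t)) \<le> length (llist I)"
  then have "real (2 * rbt_depth t) \<le> 4 * log 2 (real (length (llist I) + 1))"
    using rbt_depth_le_log[of t "length (llist I)"] by simp
  then have "2 * rbt_depth t + 1 \<le> D"
    unfolding D_def by (simp add: le_nat_floor)
  then show "T_rbt_ins x t \<le> D \<and> T_rbt_del x t \<le> D \<and> T_rbt_max t \<le> D"
    using T_rbt_ins_le[of x t] T_rbt_del_le[of x t] T_rbt_max_le[of t] by linarith
qed

lemma length_vlist: "length (vlist I) = card (verts G)"
  using represents distinct_card[of "vlist I"] by (simp add: represents_def)

lemma length_llist: "length (llist I) = card (labels G)"
  using represents distinct_card[of "llist I"] by (simp add: represents_def)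

lemma length_elist: "length (elist I) = card (edges G)"
  using represents distinct_card[of "map (\<lambda>(u, v). {u, v}) (elist I)"] by (simp add: represents_def)

lemma finite_edge_label_pairs: "finite (edge_label_pairs G)"
proof -
  have "edge_label_pairs G \<subseteq> edges G \<times> labels G"
    using labels by (auto simp: edge_label_pairs_def)
  moreover have "finite (edges G)"
    by (simp add: edges_eq)
  moreover have "finite (labels G)"
    using graph by (simp add: edge_labeled_graph_def)
  ultimately show ?thesis
    using finite_subset[of _ "edges G \<times> labels G"] by simp
qed

text \<open>The pairs form a \<open>Sigma\<close> over the edges. Distinct entries of
  \<open>elist I\<close> give distinct two-element sets, so the sum over edges becomes a sum over
  the list.\<close>

lemma num_pairs_eq: "num_pairs = card (edge_label_pairs G)"
proof -
  let ?f = "\<lambda>(u, v). {u, v}"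
  have edges: "edges G = set (map ?f (elist I))" and "distinct (map ?f (elist I))"
    using represents by (auto simp: represents_def)
  have "lab G e \<subseteq> labels G" "finite (labels G)" if "e \<in> edges G" for e
    using that graph by (auto simp: edge_labeled_graph_def)
  then have "finite (lab G e)" if "e \<in> edges G" for e
    using that finite_subset by blast
  moreover have "edge_label_pairs G = Sigma (edges G) (lab G)"
    by (auto simp: edge_label_pairs_def)
  ultimately have "card (edge_label_pairs G) = (\<Sum>e\<in>edges G. card (lab G e))"
    by (simp add: edges)
  also have "\<dots> = (\<Sum>e\<leftarrow>map ?f (elist I). card (lab G e))"
    unfolding edges using \<open>distinct (map ?f (elist I))\<close> by (rule sum_list_distinct_conv_sum_set[symmetric])
  also have "\<dots> = num_pairs"
  proof -
    have "card (lab G (?f e)) = length (labs I e)" if "e \<in> set (elist I)" for e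
      using that labs_edge[of "fst e" "snd e"] distinct_card[of "labs I e"] by (simp add: case_prod_beta)
    then show ?thesis
      unfolding num_pairs_def map_map by (intro arg_cong[where f = sum_list] map_cong) simp_all
  qed
  finally show ?thesis ..
qed

text \<open>Every label occurs on some edge, so projecting the pairs to their labels hits all of
  \<open>labels G\<close>.\<close>

lemma length_llist_le_num_pairs: "length (llist I) \<le> num_pairs"
proof -
  have "labels G = snd ` edge_label_pairs G"
    using labels by (auto simp: edge_label_pairs_def image_iff)
  then show ?thesis
    using card_image_le[OF finite_edge_label_pairs] by (simp add: length_llist num_pairs_eq)
qed

text \<open>Serves the case of at most one label, where the logarithm vanishes and the number of
  edges has to absorb the number of pairs.\<close>

lemma num_pairs_le: "num_pairs \<le> length (llist I) * length (elist I)"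
proof -
  have "length (labs I e) \<le> length (llist I)" if "e \<in> set (elist I)" for e
    using card_mono[OF _ labs_subset[OF that]] distinct_card[OF distinct_labs[OF that]]
      distinct_card[OF distinct_llist] by simp
  then have "num_pairs \<le> (\<Sum>e\<leftarrow>elist I. length (llist I))"
    unfolding num_pairs_def by (rule sum_list_mono)
  then show ?thesis
    by (simp add: sum_list_triv mult.commute)
qed

lemma budget_le: "real (budget + 2) \<le> 310 * time_bound G"
proof -
  let ?n = "length (llist I)" and ?p = "real num_pairs" and ?V = "real (length (vlist I))"
    and ?E = "real (length (elist I))"
  let ?lg = "log 2 (real ?n)"
  \<comment> \<open>Without labels this rests on the convention \<open>ln 0 = 0\<close>.\<close>
  have lg0: "?lg \<ge> 0"
    by (cases "llist I") (auto simp: log_def)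
  have "log 2 (real (?n + 1)) \<le> ?lg + 1"
  proof (cases "?n = 0")
    case False
    then have "log 2 (real (?n + 1)) \<le> log 2 (2 * real ?n)"
      by (simp add: Suc_le_eq)
    also have "\<dots> = ?lg + 1"
      using False by (simp add: log_mult)
    finally show ?thesis .
  qed (simp add: log_def)
  moreover have "real D \<le> 4 * log 2 (real (?n + 1)) + 1"
    unfolding D_def by simp
  ultimately have D: "real D \<le> 4 * ?lg + 5"
    by linarith
  \<comment> \<open>With two or more labels the logarithm is at least 1; otherwise there is at most
    one pair per edge.\<close>
  have p: "?p \<le> ?p * ?lg + ?E"
  proof (cases "?n \<ge> 2")
    case True
    then have "?lg \<ge> 1"
      by (subst le_log_iff) auto
    then have "?p * 1 \<le> ?p * ?lg"
      by (intro mult_left_mono) auto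
    then show ?thesis
      by simp
  next
    case False
    then have "length (llist I) * length (elist I) \<le> 1 * length (elist I)"
      by (intro mult_le_mono1) simp
    then have "num_pairs \<le> length (elist I)"
      using num_pairs_le by linarith
    moreover have "?p * ?lg \<ge> 0"
      using lg0 by simp
    ultimately show ?thesis
      by linarith
  qed
  \<comment> \<open>A nonempty vertex set lets \<open>?V\<close> absorb the constant 32.\<close>
  have V: "?V \<ge> 1"
    using verts graph card_gt_0_iff[of "verts G"] by (simp add: length_vlist edge_labeled_graph_def Suc_le_eq)
  have "real (budget + 2) = 3 * ?V + 22 * ?E + (5 * real D + 60) * real ?n + (9 * real D + 120) * ?p + 32"
    by (simp add: budget_def)
  also have "\<dots> \<le> 3 * ?V + 22 * ?E + (5 * real D + 60) * ?p + (9 * real D + 120) * ?p + 32"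
    using length_llist_le_num_pairs by (intro add_mono mult_left_mono) auto
  also have "\<dots> = 3 * ?V + 22 * ?E + (14 * real D + 180) * ?p + 32"
    by (simp add: algebra_simps)
  also have "\<dots> \<le> 3 * ?V + 22 * ?E + (14 * (4 * ?lg + 5) + 180) * ?p + 32"
    using D by (intro add_mono mult_right_mono) auto
  also have "\<dots> = 3 * ?V + 22 * ?E + 56 * (?p * ?lg) + 250 * ?p + 32"
    by (simp add: algebra_simps)
  \<comment> \<open>By \<open>p\<close> and \<open>V\<close> the coefficients of
    \<open>?p * ?lg\<close>, \<open>?V\<close> and \<open>?E\<close> become 306, 35 and 272, all at
    most 310.\<close>
  also have "\<dots> \<le> 310 * (?p * ?lg + ?V + ?E)"
    using p V lg0 by (simp add: algebra_simps)
  also have "\<dots> = 310 * time_bound G"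
    by (simp add: time_bound_def num_pairs_eq length_llist length_vlist length_elist)
  finally show ?thesis .
qed

end

theorem theorem7:
  fixes \<alpha> :: real
  shows "(\<lambda>(G, I). real (running_time (greedy_and \<alpha> I)))
           \<in> O[instances :: (('v, 'l::linorder) elgraph \<times> ('v, 'l) input) filter](\<lambda>(G, I). time_bound G)
       \<and> (\<lambda>(G, I). real (running_time (greedy_or \<alpha> I)))
           \<in> O[instances :: (('v, 'l::linorder) elgraph \<times> ('v, 'l) input) filter](\<lambda>(G, I). time_bound G)"
proof -
  \<comment> \<open>One constant for all instances is what a principal filter asks for; the absolute
    value is the norm in the definition of \<open>O\<close>.\<close>
  have "real (running_time (greedy_and \<alpha> I)) \<le> 310 * \<bar>time_bound G\<bar>
      \<and> real (running_time (greedy_or \<alpha> I)) \<le> 310 * \<bar>time_bound G\<bar>"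
    if "edge_labeled_graph G" "verts G \<noteq> {}" "labels G = (\<Union>e \<in> edges G. lab G e)" "represents I G"
    for G :: "('v, 'l) elgraph" and I
  proof -
    interpret graph_input G I
      using that by unfold_locales
    show ?thesis
      using running_time_greedy_and[of \<alpha>] running_time_greedy_or[of \<alpha>] budget_le abs_ge_self[of "time_bound G"]
      by linarith
  qed
  then show ?thesis
    by (auto intro!: landau_o.bigI[of 310] simp: instances_def eventually_principal)
qed

end
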